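(* Let $S$ be a compact connected orientable surface, let $S'\to S$ be a finite regular cover, and suppose that $\operatorname{rk}(H_1^s(S',\mathbb{Q}))<\operatorname{rk}(H_1(S',\mathbb{Q}))$. Then there exist $d\geq 1$ and a linear representation $\rho\colon\pi_1(S)\to\mathrm{GL}_d(\mathbb{Z})$ such that: (1) the image of $\rho$ is infinite; (2) the image under $\rho$ of every simple element of $\pi_1(S)$ has finite order. In fact, $\rho$ can be chosen so that its image is virtually abelian (i.e. the image of $\rho$ has a finite index abelian subgroup).
   Context: A simple closed curve on $S$ is an essential embedding of $S^1$ into $S$; curves freely homotopic to boundary components are counted as simple. An element $1\ne\gamma\in\pi_1(S)$ is simple if its conjugacy class has a representative which is a simple closed curve. Covers are connected; identify $\pi_1(S')$ with a finite index subgroup of $\pi_1(S)$. For simple $\gamma\in\pi_1(S)$ let $n(\gamma)$ be the smallest positive integer with $\gamma^{n(\gamma)}\in\pi_1(S')$. $H_1^s(S',\mathbb{Q})\subseteq H_1(S',\mathbb{Q})$ is the rational span of the homology classes $[\gamma^{n(\gamma)}]$ in $S'$, over all simple $\gamma\in\pi_1(S)$. $\operatorname{rk}$ denotes dimension over $\mathbb{Q}$. *)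

theory Defs
  imports
    "HOL-Analysis.Analysis"
    "HOL-Homology.Homology"
    "Jordan_Normal_Form.VS_Connect"
begin

section \<open>Surfaces\<close>

text \<open>Spaces are subsets of a topological type, with the subspace topology.  Charts take values
  in the closed upper half plane, so boundary is allowed.\<close>

definition surface :: "'a::topological_space set \<Rightarrow> bool" where
  "surface S \<longleftrightarrow>
     Hausdorff_space (top_of_set S) \<and> second_countable (top_of_set S) \<and>
     (\<forall>x\<in>S. \<exists>U V. x \<in> U \<and> openin (top_of_set S) U \<and>
        openin (top_of_set {z::complex. Im z \<ge> 0}) V \<and> U homeomorphic V)"

definition surface_interior :: "'a::topological_space set \<Rightarrow> 'a set" where
  "surface_interior S =
     {x \<in> S. \<exists>U V. x \<in> U \<and> openin (top_of_set S) U \<and> open (V::complex set) \<and> U homeomorphic V}"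

text \<open>An orientation of a surface without boundary \<open>M\<close> chooses a generator of
  \<open>H\<^sub>2(M, M - {x}; \<int>)\<close> for every \<open>x\<close>, locally induced by a single class of
  \<open>H\<^sub>2(M, M - B; \<int>)\<close>.  A surface with boundary is orientable if its interior is.\<close>

definition orientation :: "'a::topological_space set \<Rightarrow> ('a \<Rightarrow> 'a chain set) \<Rightarrow> bool" where
  "orientation M \<mu> \<longleftrightarrow>
     (\<forall>x\<in>M. \<mu> x \<in> carrier (relative_homology_group 2 (top_of_set M) (M - {x})) \<and>
        generate (relative_homology_group 2 (top_of_set M) (M - {x})) {\<mu> x} =
          carrier (relative_homology_group 2 (top_of_set M) (M - {x}))) \<and>
     (\<forall>x\<in>M. \<exists>B. x \<in> B \<and> openin (top_of_set M) B \<and>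
        (\<exists>\<beta> \<in> carrier (relative_homology_group 2 (top_of_set M) (M - B)).
           \<forall>y\<in>B. hom_induced 2 (top_of_set M) (M - B) (top_of_set M) (M - {y}) id \<beta> = \<mu> y))"

definition orientable_surface :: "'a::topological_space set \<Rightarrow> bool" where
  "orientable_surface S \<longleftrightarrow> surface S \<and> (\<exists>\<mu>. orientation (surface_interior S) \<mu>)"


section \<open>Fundamental groups and covers\<close>

definition loop_at :: "'a::topological_space set \<Rightarrow> 'a \<Rightarrow> (real \<Rightarrow> 'a) \<Rightarrow> bool" where
  "loop_at S x g \<longleftrightarrow> path g \<and> path_image g \<subseteq> S \<and> pathstart g = x \<and> pathfinish g = x"

definition path_class :: "'a::topological_space set \<Rightarrow> (real \<Rightarrow> 'a) \<Rightarrow> (real \<Rightarrow> 'a) set" where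
  "path_class S g = {h. homotopic_paths S g h}"

definition fundamental_group :: "'a::topological_space set \<Rightarrow> 'a \<Rightarrow> (real \<Rightarrow> 'a) set monoid" where
  "fundamental_group S x =
     \<lparr>carrier = path_class S ` Collect (loop_at S x),
      monoid.mult = (\<lambda>A B. \<Union>g\<in>A. \<Union>h\<in>B. path_class S (g +++ h)),
      one = path_class S (\<lambda>_. x)\<rparr>"

definition pi1_map ::
  "('b::topological_space \<Rightarrow> 'a::topological_space) \<Rightarrow> 'a set \<Rightarrow> (real \<Rightarrow> 'b) set \<Rightarrow> (real \<Rightarrow> 'a) set"
  where "pi1_map p S A = (\<Union>g\<in>A. path_class S (p \<circ> g))"

text \<open>The copy of \<open>\<pi>\<^sub>1(S')\<close> inside \<open>\<pi>\<^sub>1(S)\<close> determined by a cover \<open>p\<close> of pointed spaces.\<close>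

definition cover_subgroup ::
  "'b::topological_space set \<Rightarrow> 'b \<Rightarrow> ('b \<Rightarrow> 'a::topological_space) \<Rightarrow> 'a set \<Rightarrow> (real \<Rightarrow> 'a) set set"
  where "cover_subgroup S' y p S = pi1_map p S ` carrier (fundamental_group S' y)"

definition finite_regular_cover ::
  "'b::topological_space set \<Rightarrow> 'b \<Rightarrow> ('b \<Rightarrow> 'a::topological_space) \<Rightarrow> 'a set \<Rightarrow> bool" where
  "finite_regular_cover S' y p S \<longleftrightarrow>
     y \<in> S' \<and> connected S' \<and> covering_space S' p S \<and>
     (\<forall>x\<in>S. finite {z\<in>S'. p z = x}) \<and>
     cover_subgroup S' y p S \<lhd> fundamental_group S (p y)"


section \<open>Simple elements\<close>

text \<open>Essential means not null-homotopic: boundary parallel curves count as simple closed curves.\<close>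

definition simple_closed_curve :: "'a::topological_space set \<Rightarrow> (real \<Rightarrow> 'a) \<Rightarrow> bool" where
  "simple_closed_curve S c \<longleftrightarrow>
     simple_path c \<and> pathfinish c = pathstart c \<and> path_image c \<subseteq> S \<and>
     \<not> (\<exists>a. homotopic_loops S c (\<lambda>_. a))"

text \<open>The conjugacy class of a based loop is its free homotopy class.\<close>

definition simple_element :: "'a::topological_space set \<Rightarrow> 'a \<Rightarrow> (real \<Rightarrow> 'a) set \<Rightarrow> bool" where
  "simple_element S x \<gamma> \<longleftrightarrow>
     \<gamma> \<in> carrier (fundamental_group S x) \<and> \<gamma> \<noteq> \<one>\<^bsub>fundamental_group S x\<^esub> \<and>
     (\<exists>g\<in>\<gamma>. \<exists>c. simple_closed_curve S c \<and> homotopic_loops S g c)"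


section \<open>Rational singular homology\<close>

text \<open>The distribution's singular homology has integer coefficients; this is that construction
  on chains with rational coefficients.\<close>

type_synonym 'a rat_chain = "((nat \<Rightarrow> real) \<Rightarrow> 'a) \<Rightarrow>\<^sub>0 rat"

definition rat_chains :: "nat \<Rightarrow> 'a topology \<Rightarrow> 'a rat_chain set" where
  "rat_chains n X = {c. Poly_Mapping.keys c \<subseteq> singular_simplex_set n X}"

definition rat_boundary :: "nat \<Rightarrow> 'a rat_chain \<Rightarrow> 'a rat_chain" where
  "rat_boundary n c =
     (if n = 0 then 0 else
        (\<Sum>\<sigma>\<in>Poly_Mapping.keys c. \<Sum>k\<le>n.
           Poly_Mapping.single (singular_face n k \<sigma>) ((-1) ^ k * Poly_Mapping.lookup c \<sigma>)))"

definition rat_cycles :: "nat \<Rightarrow> 'a topology \<Rightarrow> 'a rat_chain set" where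
  "rat_cycles n X = {c \<in> rat_chains n X. rat_boundary n c = 0}"

definition rat_boundaries :: "nat \<Rightarrow> 'a topology \<Rightarrow> 'a rat_chain set" where
  "rat_boundaries n X = rat_boundary (Suc n) ` rat_chains (Suc n) X"

definition rat_homology_class :: "nat \<Rightarrow> 'a topology \<Rightarrow> 'a rat_chain \<Rightarrow> 'a rat_chain set" where
  "rat_homology_class n X c = {c + b | b. b \<in> rat_boundaries n X}"

text \<open>A vector space over the field \<^term>\<open>class_ring :: rat ring\<close>; the fields \<open>mult\<close> and \<open>one\<close>
  that module records inherit from rings play no role.\<close>

definition rat_homology :: "nat \<Rightarrow> 'a topology \<Rightarrow> (rat, 'a rat_chain set) module" where
  "rat_homology n X =
     \<lparr>carrier = rat_homology_class n X ` rat_cycles n X,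
      monoid.mult = undefined,
      one = undefined,
      zero = rat_boundaries n X,
      add = (\<lambda>A B. \<Union>a\<in>A. \<Union>b\<in>B. rat_homology_class n X (a + b)),
      smult = (\<lambda>q A. \<Union>a\<in>A. rat_homology_class n X (Poly_Mapping.map ((*) q) a))\<rparr>"

definition path_simplex :: "(real \<Rightarrow> 'a) \<Rightarrow> (nat \<Rightarrow> real) \<Rightarrow> 'a" where
  "path_simplex g = restrict (\<lambda>t. g (t 1)) (standard_simplex 1)"

definition loop_homology_class :: "'a::topological_space set \<Rightarrow> (real \<Rightarrow> 'a) \<Rightarrow> 'a rat_chain set" where
  "loop_homology_class S g =
     rat_homology_class 1 (top_of_set S) (Poly_Mapping.single (path_simplex g) 1)"


section \<open>Simple homology of a cover\<close>

definition simple_exponent ::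
  "'b::topological_space set \<Rightarrow> 'b \<Rightarrow> ('b \<Rightarrow> 'a::topological_space) \<Rightarrow> 'a set \<Rightarrow> (real \<Rightarrow> 'a) set \<Rightarrow> nat"
  where
  "simple_exponent S' y p S \<gamma> =
     (LEAST n. 0 < n \<and> \<gamma> [^]\<^bsub>fundamental_group S (p y)\<^esub> n \<in> cover_subgroup S' y p S)"

text \<open>\<open>\<gamma>\<close> to the power \<open>simple_exponent \<dots> \<gamma>\<close> lies in the copy of \<open>\<pi>\<^sub>1(S')\<close>; its class in
  \<open>H\<^sub>1(S')\<close> is that of any loop \<open>g\<close> at \<open>y\<close> whose projection represents it.\<close>

definition simple_homology ::
  "'b::topological_space set \<Rightarrow> 'b \<Rightarrow> ('b \<Rightarrow> 'a::topological_space) \<Rightarrow> 'a set \<Rightarrow> 'b rat_chain set set"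
  where
  "simple_homology S' y p S =
     LinearCombinations.module.span class_ring (rat_homology 1 (top_of_set S'))
       {loop_homology_class S' g | g \<gamma>.
          simple_element S (p y) \<gamma> \<and> loop_at S' y g \<and>
          p \<circ> g \<in> \<gamma> [^]\<^bsub>fundamental_group S (p y)\<^esub> simple_exponent S' y p S \<gamma>}"

definition rk_homology :: "'b::topological_space set \<Rightarrow> nat" where
  "rk_homology S' = vectorspace.dim class_ring (rat_homology 1 (top_of_set S'))"

definition rk_simple_homology ::
  "'b::topological_space set \<Rightarrow> 'b \<Rightarrow> ('b \<Rightarrow> 'a::topological_space) \<Rightarrow> 'a set \<Rightarrow> nat" where
  "rk_simple_homology S' y p S =
     vectorspace.dim class_ring
       (rat_homology 1 (top_of_set S')\<lparr>carrier := simple_homology S' y p S\<rparr>)"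


section \<open>Integral general linear groups and virtually abelian groups\<close>

definition GL_int :: "nat \<Rightarrow> int mat monoid" where
  "GL_int d = units_of (ring_mat TYPE(int) d ())"

definition virtually_abelian :: "('a, 'b) monoid_scheme \<Rightarrow> bool" where
  "virtually_abelian G \<longleftrightarrow>
     (\<exists>A. subgroup A G \<and> comm_group (G\<lparr>carrier := A\<rparr>) \<and> finite (rcosets\<^bsub>G\<^esub> A))"

end

theory Submission
  imports Defs
begin

text \<open>If simple classes do not span \<open>H\<^sub>1(S', \<rat>)\<close>, some rational functional on it is
  nonzero but kills them all.  As \<open>S'\<close> is compact and locally modelled on convex sets, the
  values of the functional on loops have bounded denominators, so that a multiple of it is an
  integral homomorphism \<open>\<phi>\<close> on the normal finite index subgroup \<open>\<pi>\<^sub>1(S')\<close> of \<open>\<pi>\<^sub>1(S)\<close>.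
  The representation induced from the unipotent one \<open>n \<mapsto> (1, \<phi> n; 0, 1)\<close> is infinite, and
  abelian on \<open>\<pi>\<^sub>1(S')\<close>; it is trivial on the power of a simple element that lies in
  \<open>\<pi>\<^sub>1(S')\<close>, because all conjugates of that power are powers of simple elements.\<close>

section \<open>Induced integral representations\<close>

text \<open>The obstacle is that \<phi> need not be invariant under conjugation by \<pi>_1(S), so in
  general it does not extend to the whole group. Induction gets around this by recording the values
  of \<phi> on conjugates all at once. An element of the normal subgroup then acts trivially as soon
  as \<phi> kills all its conjugates, which fits simple elements because simplicity is invariant
  under conjugation. The separating functional is constructed on all rational chains rather than on
  homology. It therefore assigns a number to every path, closed or not, and its vanishing on
  boundaries becomes additivity around triangles. This is what gives a meaning to local primitives.
  A rational functional could a priori have unbounded denominators on the loops of S'. Integrality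
  is obtained from a finite cover by charts instead of from a finite set of generators of
  \<pi>_1(S'): only finitely many transition constants between local primitives occur, and one
  integer clears them all.\<close>

locale coset_representatives = group G for G (structure) +
  fixes N :: "'a set" and m :: nat and r :: "nat \<Rightarrow> 'a" and \<phi> :: "'a \<Rightarrow> int"
  assumes N: "N \<lhd> G"
    and r: "\<And>i. i < m \<Longrightarrow> r i \<in> carrier G"
    and r_unique: "\<And>x. x \<in> carrier G \<Longrightarrow> \<exists>!i. i < m \<and> x \<otimes> inv (r i) \<in> N"
    and \<phi>: "\<And>x y. x \<in> N \<Longrightarrow> y \<in> N \<Longrightarrow> \<phi> (x \<otimes> y) = \<phi> x + \<phi> y"
begin

text \<open>The representation induced from \<open>n \<mapsto> (1, \<phi> n; 0, 1)\<close>, in the basis that lists the first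
  vectors of all cosets before the second ones.\<close>

definition link :: "'a \<Rightarrow> nat \<Rightarrow> nat \<Rightarrow> 'a" where
  "link g i j = r i \<otimes> g \<otimes> inv (r j)"

text \<open>\<open>link g i j\<close> is the element n with \<open>r i\<close> g = n
  \<open>r j\<close>. It lies in \<open>N\<close> exactly when right multiplication by
  \<open>g\<close> carries the coset of \<open>r i\<close> to that of \<open>r j\<close>, so this is
  the permutation matrix of \<open>g\<close> on the right cosets.\<close>

definition perm_block :: "'a \<Rightarrow> int mat" where
  "perm_block g = mat m m (\<lambda>(i, j). if link g i j \<in> N then 1 else 0)"

text \<open>\<phi> is read at elements of \<open>N\<close> only. The nonzero entries sit at
  positions of the permutation matrix and are the upper right corners of the two by two unipotent
  matrices.\<close>

definition shift_block :: "'a \<Rightarrow> int mat" where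
  "shift_block g = mat m m (\<lambda>(i, j). if link g i j \<in> N then \<phi> (link g i j) else 0)"

definition induced :: "'a \<Rightarrow> int mat" where
  "induced g = four_block_mat (perm_block g) (shift_block g) (0\<^sub>m m m) (perm_block g)"

lemma N_subgroup: "subgroup N G"
  using N by (rule normal_imp_subgroup)

lemma N_carrier: "x \<in> N \<Longrightarrow> x \<in> carrier G"
  by (rule subgroup.mem_carrier[OF N_subgroup])

lemma link_closed: "g \<in> carrier G \<Longrightarrow> i < m \<Longrightarrow> j < m \<Longrightarrow> link g i j \<in> carrier G"
  unfolding link_def using r by simp

text \<open>The cocycle identity: the factors \<open>inv (r j)\<close> and \<open>r j\<close> in the
  middle cancel.\<close>

lemma link_mult:
  assumes "g \<in> carrier G" "h \<in> carrier G" "i < m" "j < m" "k < m"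
  shows "link g i j \<otimes> link h j k = link (g \<otimes> h) i k"
proof -
  have "inv (r j) \<otimes> (r j \<otimes> (h \<otimes> inv (r k))) = h \<otimes> inv (r k)"
    using assms r by (simp add: m_assoc[symmetric])
  then show ?thesis
    unfolding link_def using assms r by (simp add: m_assoc)
qed

lemma \<phi>_one: "\<phi> \<one> = 0"
  using \<phi>[of \<one> \<one>] subgroup.one_closed[OF N_subgroup] by simp

lemma \<phi>_inv: "x \<in> N \<Longrightarrow> \<phi> (inv x) = - \<phi> x"
  using \<phi>[of x "inv x"] subgroup.m_inv_closed[OF N_subgroup, of x] N_carrier[of x] \<phi>_one
  by simp

lemma obtain_link:
  assumes "g \<in> carrier G" "i < m"
  obtains j where "j < m" "link g i j \<in> N" "\<And>l. l < m \<Longrightarrow> link g i l \<in> N \<Longrightarrow> l = j"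
proof -
  have "\<exists>!j. j < m \<and> link g i j \<in> N"
    unfolding link_def using assms r by (intro r_unique) simp
  then show ?thesis using that by blast
qed

text \<open>Row i of either block of \<open>g\<close> is supported in the single column j of the
  coset that \<open>g\<close> sends i to, so each matrix product collapses to one term. The cocycle
  identity and additivity of \<phi> on \<open>N\<close> then evaluate that term. The second equation
  is the upper right corner of a product of block triangular matrices.\<close>

lemma blocks_mult:
  assumes g: "g \<in> carrier G" and h: "h \<in> carrier G"
  shows "perm_block g * perm_block h = perm_block (g \<otimes> h)"
    and "perm_block g * shift_block h + shift_block g * perm_block h = shift_block (g \<otimes> h)"
proof -
  have *: "(\<Sum>l<m. (if link g i l \<in> N then a l else 0) * b l) = a j * (b j :: int)"
    if "i < m" "j < m" "link g i j \<in> N" "\<And>l. l < m \<Longrightarrow> link g i l \<in> N \<Longrightarrow> l = j" for i j a b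
  proof -
    have "(\<Sum>l<m. (if link g i l \<in> N then a l else 0) * b l)
        = (\<Sum>l<m. if l = j then a j * b j else 0)"
    proof (rule sum.cong)
      fix l assume "l \<in> {..<m}"
      then have "link g i l \<in> N \<longleftrightarrow> l = j" using that(3,4) by blast
      then show "(if link g i l \<in> N then a l else 0) * b l = (if l = j then a j * b j else 0)" by simp
    qed simp
    also have "\<dots> = a j * b j" using \<open>j < m\<close> by simp
    finally show ?thesis .
  qed
  \<comment> \<open>Once \<open>g\<close> sends coset i to coset j, \<open>h\<close> sends j to k
    exactly when the product sends i to k.\<close>
  have iff: "link h j k \<in> N \<longleftrightarrow> link (g \<otimes> h) i k \<in> N"
    if "i < m" "j < m" "k < m" "link g i j \<in> N" for i j k
  proof
    assume "link h j k \<in> N"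
    then show "link (g \<otimes> h) i k \<in> N"
      using link_mult[OF g h that(1-3)] subgroup.m_closed[OF N_subgroup that(4)] by metis
  next
    assume "link (g \<otimes> h) i k \<in> N"
    moreover have "link h j k = inv (link g i j) \<otimes> link (g \<otimes> h) i k"
      using link_mult[OF g h that(1-3)] link_closed g h that by (simp add: inv_solve_left)
    ultimately show "link h j k \<in> N"
      using subgroup.m_closed[OF N_subgroup] subgroup.m_inv_closed[OF N_subgroup] that(4) by metis
  qed
  show "perm_block g * perm_block h = perm_block (g \<otimes> h)"
  proof (rule eq_matI)
    fix i k assume "i < dim_row (perm_block (g \<otimes> h))" "k < dim_col (perm_block (g \<otimes> h))"
    then have i: "i < m" and k: "k < m" by (auto simp: perm_block_def)
    obtain j where j: "j < m" "link g i j \<in> N" "\<And>l. l < m \<Longrightarrow> link g i l \<in> N \<Longrightarrow> l = j"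
      using obtain_link[OF g i] by blast
    have "(perm_block g * perm_block h) $$ (i, k)
        = (\<Sum>l<m. (if link g i l \<in> N then 1 else 0) * (if link h l k \<in> N then 1 else 0))"
      using i k by (simp add: perm_block_def scalar_prod_def atLeast0LessThan)
    also have "\<dots> = (if link h j k \<in> N then 1 else 0)"
      using *[OF i j, of "\<lambda>_. 1"] by simp
    finally show "(perm_block g * perm_block h) $$ (i, k) = perm_block (g \<otimes> h) $$ (i, k)"
      using iff[OF i j(1) k j(2)] i k by (simp add: perm_block_def)
  qed (auto simp: perm_block_def)
  show "perm_block g * shift_block h + shift_block g * perm_block h = shift_block (g \<otimes> h)"
  proof (rule eq_matI)
    fix i k assume "i < dim_row (shift_block (g \<otimes> h))" "k < dim_col (shift_block (g \<otimes> h))"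
    then have i: "i < m" and k: "k < m" by (auto simp: shift_block_def)
    obtain j where j: "j < m" "link g i j \<in> N" "\<And>l. l < m \<Longrightarrow> link g i l \<in> N \<Longrightarrow> l = j"
      using obtain_link[OF g i] by blast
    have "(perm_block g * shift_block h + shift_block g * perm_block h) $$ (i, k)
        = (\<Sum>l<m. (if link g i l \<in> N then 1 else 0) *
                   (if link h l k \<in> N then \<phi> (link h l k) else 0))
        + (\<Sum>l<m. (if link g i l \<in> N then \<phi> (link g i l) else 0) *
                   (if link h l k \<in> N then 1 else 0))"
      using i k by (simp add: perm_block_def shift_block_def scalar_prod_def atLeast0LessThan)
    also have "\<dots> = (if link h j k \<in> N then \<phi> (link g i j) + \<phi> (link h j k) else 0)"
      using *[OF i j, of "\<lambda>_. 1"] *[OF i j, of "\<lambda>l. \<phi> (link g i l)"] by simp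
    finally show "(perm_block g * shift_block h + shift_block g * perm_block h) $$ (i, k)
        = shift_block (g \<otimes> h) $$ (i, k)"
      using iff[OF i j(1) k j(2)] i k \<phi>[OF j(2), of "link h j k"] link_mult[OF g h i j(1) k]
      by (simp add: shift_block_def)
  qed (auto simp: perm_block_def shift_block_def)
qed

lemma induced_carrier: "induced g \<in> carrier_mat (m + m) (m + m)"
  unfolding induced_def perm_block_def shift_block_def by (intro four_block_carrier_mat) auto

lemma induced_mult:
  assumes "g \<in> carrier G" "h \<in> carrier G"
  shows "induced g * induced h = induced (g \<otimes> h)"
proof -
  have P: "perm_block x \<in> carrier_mat m m" and D: "shift_block x \<in> carrier_mat m m" for x
    by (auto simp: perm_block_def shift_block_def)
  show ?thesis
    unfolding induced_def
    by (subst mult_four_block_mat[OF P D zero_carrier_mat P P D zero_carrier_mat P])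
      (use P[of g] P[of h] P[of "g \<otimes> h"] D[of g] D[of h] blocks_mult[OF assms] in simp)
qed

text \<open>By normality \<open>x\<close> fixes every coset, so the permutation block is the
  identity. The diagonal of the other block consists of the values of \<phi> on the conjugates of
  \<open>x\<close> by the representatives.\<close>

lemma induced_eq_one:
  assumes x: "x \<in> N" and zero: "\<And>t. t \<in> carrier G \<Longrightarrow> \<phi> (t \<otimes> x \<otimes> inv t) = 0"
  shows "induced x = 1\<^sub>m (m + m)"
proof -
  have l: "link x i j \<in> N \<longleftrightarrow> i = j" if ij: "i < m" "j < m" for i j
  proof -
    obtain k where k: "\<And>l. l < m \<Longrightarrow> link x i l \<in> N \<Longrightarrow> l = k"
      using obtain_link[OF N_carrier[OF x] ij(1)] by metis
    have "link x i i \<in> N"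
      unfolding link_def using normal.inv_op_closed2[OF N r[OF ij(1)] x] by simp
    with k[of i] k[of j] ij show ?thesis by auto
  qed
  have "perm_block x = 1\<^sub>m m"
    by (rule eq_matI) (auto simp: perm_block_def l)
  moreover have "\<phi> (link x i i) = 0" if "i < m" for i
    unfolding link_def using zero r that by blast
  then have "shift_block x = 0\<^sub>m m m"
    by (intro eq_matI) (auto simp: shift_block_def l)
  ultimately show ?thesis
    unfolding induced_def by simp
qed

text \<open>Invertibility over the integers is witnessed by the matrix of the inverse element, which
  is again integral.\<close>

lemma induced_hom: "induced \<in> hom G (GL_int (m + m))"
proof -
  let ?R = "ring_mat TYPE(int) (m + m) ()"
  interpret R: semiring ?R by (rule semiring_mat)
  have one: "induced \<one> = 1\<^sub>m (m + m)"
    using subgroup.one_closed[OF N_subgroup] by (intro induced_eq_one) (auto simp: \<phi>_one)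
  have "induced g \<in> Units ?R" if "g \<in> carrier G" for g
  proof -
    have "induced g * induced (inv g) = 1\<^sub>m (m + m)" "induced (inv g) * induced g = 1\<^sub>m (m + m)"
      using that by (simp_all add: induced_mult one)
    then show ?thesis
      unfolding Units_def ring_mat_simps using induced_carrier by blast
  qed
  then show ?thesis
    unfolding GL_int_def by (auto simp: hom_def units_of_def ring_mat_simps induced_mult)
qed

end

section \<open>Infinite, virtually abelian images in integral linear groups\<close>

lemma group_GL_int: "group (GL_int d)"
proof -
  interpret semiring "ring_mat TYPE(int) d ()" by (rule semiring_mat)
  show ?thesis unfolding GL_int_def by (rule units_group)
qed

text \<open>The image of \<open>N\<close> is the required subgroup: every coset of it is the image
  of a coset of \<open>N\<close>, so finiteness of the index passes to the image.\<close>

lemma virtually_abelian_image: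
  assumes G: "group G" and H: "group H" and f: "f \<in> hom G H"
    and N: "subgroup N G" and fin: "finite (rcosets\<^bsub>G\<^esub> N)"
    and comm: "\<And>x y. x \<in> N \<Longrightarrow> y \<in> N \<Longrightarrow> f x \<otimes>\<^bsub>H\<^esub> f y = f y \<otimes>\<^bsub>H\<^esub> f x"
  shows "virtually_abelian (H\<lparr>carrier := f ` carrier G\<rparr>)"
proof -
  interpret f: group_hom G H f
    using G H f by (simp add: group_hom_def group_hom_axioms_def)
  let ?I = "H\<lparr>carrier := f ` carrier G\<rparr>"
  have sub: "subgroup (f ` carrier G) H" by (rule f.img_is_subgroup)
  have I: "group ?I" using H sub by (rule group.subgroup_imp_group)
  have NC: "N \<subseteq> carrier G" using N by (rule subgroup.subset)
  have "subgroup (f ` N) H" using N by (rule f.subgroup_img_is_subgroup)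
  then have fN: "subgroup (f ` N) ?I"
    using NC by (intro group.subgroup_incl[OF H _ sub]) auto
  then have "group (?I\<lparr>carrier := f ` N\<rparr>)"
    by (rule group.subgroup_imp_group[OF I])
  then have "comm_group (?I\<lparr>carrier := f ` N\<rparr>)"
    by (intro group.group_comm_groupI) (auto simp: comm)
  moreover have "rcosets\<^bsub>?I\<^esub> (f ` N) \<subseteq> (`) f ` (rcosets\<^bsub>G\<^esub> N)"
  proof
    fix C assume "C \<in> rcosets\<^bsub>?I\<^esub> (f ` N)"
    then obtain g where g: "g \<in> carrier G" "C = f ` N #>\<^bsub>?I\<^esub> f g"
      by (auto simp: RCOSETS_def)
    have "C = f ` (N #>\<^bsub>G\<^esub> g)"
      using NC g by (auto simp: r_coset_def image_iff subset_iff)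
    with g show "C \<in> (`) f ` (rcosets\<^bsub>G\<^esub> N)"
      by (auto simp: RCOSETS_def)
  qed
  ultimately show ?thesis
    unfolding virtually_abelian_def using fN fin finite_surj by blast
qed

text \<open>The dimension is twice the index of \<open>N\<close>. The image is infinite because one
  corner entry of the matrix of the k-th power of \<open>a\<close> is k times \<phi> of
  \<open>a\<close>. It is abelian on \<open>N\<close> because commutators, together with all their
  conjugates, are killed by a homomorphism to the integers.\<close>

theorem integral_representation:
  assumes G: "group G" and N: "N \<lhd> G" and fin: "finite (rcosets\<^bsub>G\<^esub> N)"
    and \<phi>: "\<And>x y. x \<in> N \<Longrightarrow> y \<in> N \<Longrightarrow> \<phi> (x \<otimes>\<^bsub>G\<^esub> y) = \<phi> x + (\<phi> y :: int)"
    and a: "a \<in> N" "\<phi> a \<noteq> 0"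
  shows "\<exists>d \<rho>. d \<ge> 1 \<and> \<rho> \<in> hom G (GL_int d) \<and> infinite (\<rho> ` carrier G) \<and>
    (\<forall>x\<in>N. (\<forall>t\<in>carrier G. \<phi> (t \<otimes>\<^bsub>G\<^esub> x \<otimes>\<^bsub>G\<^esub> inv\<^bsub>G\<^esub> t) = 0) \<longrightarrow> \<rho> x = \<one>\<^bsub>GL_int d\<^esub>) \<and>
    virtually_abelian (GL_int d\<lparr>carrier := \<rho> ` carrier G\<rparr>)"
proof -
  interpret G: group G by fact
  have subN: "subgroup N G" using N by (rule normal_imp_subgroup)
  have NC: "N \<subseteq> carrier G" using subN by (rule subgroup.subset)
  obtain C where C: "bij_betw C {..<card (rcosets\<^bsub>G\<^esub> N)} (rcosets\<^bsub>G\<^esub> N)"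
    using ex_bij_betw_nat_finite[OF fin] by (auto simp: atLeast0LessThan)
  define m where "m = card (rcosets\<^bsub>G\<^esub> N)"
  have C_in: "C i \<in> rcosets\<^bsub>G\<^esub> N" if "i < m" for i
    using C that by (auto simp: bij_betw_def m_def)
  define r where "r i = (SOME x. x \<in> carrier G \<and> C i = N #>\<^bsub>G\<^esub> x)" for i
  have r: "r i \<in> carrier G \<and> C i = N #>\<^bsub>G\<^esub> r i" if "i < m" for i
  proof -
    have "\<exists>x. x \<in> carrier G \<and> C i = N #>\<^bsub>G\<^esub> x" using C_in[OF that] by (auto simp: RCOSETS_def)
    then show ?thesis unfolding r_def by (rule someI_ex)
  qed
  have mem: "x \<otimes>\<^bsub>G\<^esub> inv\<^bsub>G\<^esub> r i \<in> N \<longleftrightarrow> N #>\<^bsub>G\<^esub> x = C i" if "x \<in> carrier G" "i < m" for x i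
    using r[OF that(2)] that(1) NC subN
    by (metis G.coset_join1 G.coset_join2 G.coset_mult_inv1 G.coset_mult_inv2 G.inv_closed G.m_closed)
  interpret coset_representatives G N m r \<phi>
  proof (intro coset_representatives.intro coset_representatives_axioms.intro)
    fix x assume x: "x \<in> carrier G"
    then have "N #>\<^bsub>G\<^esub> x \<in> rcosets\<^bsub>G\<^esub> N" using NC by (intro G.rcosetsI)
    then have "N #>\<^bsub>G\<^esub> x \<in> C ` {..<m}"
      using C by (simp add: bij_betw_def m_def)
    then obtain i where "i < m" "C i = N #>\<^bsub>G\<^esub> x" by auto
    moreover have "j = i" if "j < m" "C j = C i" for j
      using C that \<open>i < m\<close> by (auto simp: bij_betw_def m_def inj_on_def)
    ultimately show "\<exists>!i. i < m \<and> x \<otimes>\<^bsub>G\<^esub> inv\<^bsub>G\<^esub> r i \<in> N"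
      using mem[OF x] by metis
  qed (use G N \<phi> r in auto)
  \<comment> \<open>The index of the coset \<open>N\<close> itself. Its representative need not be
    the identity, but it lies in \<open>N\<close>, so conjugating by it does not change
    \<phi>.\<close>
  obtain i0 where i0: "i0 < m" "\<one>\<^bsub>G\<^esub> \<otimes>\<^bsub>G\<^esub> inv\<^bsub>G\<^esub> r i0 \<in> N"
    using r_unique[OF G.one_closed] by auto
  then have r0: "r i0 \<in> N"
    using r[OF i0(1)] subgroup.m_inv_closed[OF subN] by fastforce
  have power: "a [^]\<^bsub>G\<^esub> k \<in> N \<and> \<phi> (a [^]\<^bsub>G\<^esub> k) = int k * \<phi> a" for k :: nat
    by (induction k)
      (auto simp: a \<phi> \<phi>_one algebra_simps subgroup.one_closed[OF subN] intro: subgroup.m_closed[OF subN])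
  have conj: "link x i0 i0 \<in> N \<and> \<phi> (link x i0 i0) = \<phi> x" if "x \<in> N" for x
    using that r0 subgroup.m_closed[OF subN] subgroup.m_inv_closed[OF subN]
    by (simp add: link_def \<phi> \<phi>_inv)
  have "induced (a [^]\<^bsub>G\<^esub> k) $$ (i0, m + i0) = int k * \<phi> a" for k :: nat
    using i0(1) conj[of "a [^]\<^bsub>G\<^esub> k"] power[of k]
    by (simp add: induced_def perm_block_def shift_block_def)
  then have "inj (\<lambda>k::nat. induced (a [^]\<^bsub>G\<^esub> k))"
    using a(2) by (intro injI) (metis mult_cancel_right of_nat_eq_iff)
  then have "infinite (range (\<lambda>k::nat. induced (a [^]\<^bsub>G\<^esub> k)))"
    using finite_imageD by blast
  moreover have "range (\<lambda>k::nat. induced (a [^]\<^bsub>G\<^esub> k)) \<subseteq> induced ` carrier G"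
    using power NC by auto
  ultimately have inf: "infinite (induced ` carrier G)"
    using finite_subset by blast
  have one: "\<one>\<^bsub>GL_int (m + m)\<^esub> = 1\<^sub>m (m + m)"
    by (simp add: GL_int_def units_of_def ring_mat_simps)
  have comm: "induced x \<otimes>\<^bsub>GL_int (m + m)\<^esub> induced y = induced y \<otimes>\<^bsub>GL_int (m + m)\<^esub> induced x"
    if xy: "x \<in> N" "y \<in> N" for x y
  proof -
    \<comment> \<open>A conjugate of this commutator is the commutator of the conjugates of
      \<open>x\<close> and \<open>y\<close>, which are in \<open>N\<close> by normality. So \<phi>
      vanishes on it and the triviality criterion applies.\<close>
    let ?z = "x \<otimes>\<^bsub>G\<^esub> y \<otimes>\<^bsub>G\<^esub> inv\<^bsub>G\<^esub> x \<otimes>\<^bsub>G\<^esub> inv\<^bsub>G\<^esub> y"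
    have cl: "x \<in> carrier G" "y \<in> carrier G" using xy NC by auto
    have conjN: "t \<otimes>\<^bsub>G\<^esub> u \<otimes>\<^bsub>G\<^esub> inv\<^bsub>G\<^esub> t \<in> N" if "t \<in> carrier G" "u \<in> N" for t u
      using normal.inv_op_closed2[OF N that] .
    have z: "?z \<in> N"
      using xy subgroup.m_closed[OF subN] subgroup.m_inv_closed[OF subN] by simp
    have "\<phi> (t \<otimes>\<^bsub>G\<^esub> ?z \<otimes>\<^bsub>G\<^esub> inv\<^bsub>G\<^esub> t) = 0" if t: "t \<in> carrier G" for t
    proof -
      define u v where "u = t \<otimes>\<^bsub>G\<^esub> x \<otimes>\<^bsub>G\<^esub> inv\<^bsub>G\<^esub> t" and "v = t \<otimes>\<^bsub>G\<^esub> y \<otimes>\<^bsub>G\<^esub> inv\<^bsub>G\<^esub> t"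
      have uv: "u \<in> N" "v \<in> N" using conjN[OF t] xy by (auto simp: u_def v_def)
      have cancel: "inv\<^bsub>G\<^esub> t \<otimes>\<^bsub>G\<^esub> (t \<otimes>\<^bsub>G\<^esub> w) = w" if "w \<in> carrier G" for w
        using t that by (simp add: G.m_assoc[symmetric])
      have "t \<otimes>\<^bsub>G\<^esub> ?z \<otimes>\<^bsub>G\<^esub> inv\<^bsub>G\<^esub> t = u \<otimes>\<^bsub>G\<^esub> v \<otimes>\<^bsub>G\<^esub> inv\<^bsub>G\<^esub> u \<otimes>\<^bsub>G\<^esub> inv\<^bsub>G\<^esub> v"
        using t cl by (simp add: u_def v_def G.inv_mult_group G.m_assoc cancel)
      then show ?thesis
        using uv subgroup.m_closed[OF subN] subgroup.m_inv_closed[OF subN]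
        by (simp add: \<phi> \<phi>_inv)
    qed
    then have z1: "induced ?z = 1\<^sub>m (m + m)" by (rule induced_eq_one[OF z])
    have "x \<otimes>\<^bsub>G\<^esub> y = ?z \<otimes>\<^bsub>G\<^esub> (y \<otimes>\<^bsub>G\<^esub> x)"
    proof -
      have "inv\<^bsub>G\<^esub> y \<otimes>\<^bsub>G\<^esub> (y \<otimes>\<^bsub>G\<^esub> x) = x"
        using cl by (simp add: G.m_assoc[symmetric])
      then show ?thesis using cl by (simp add: G.m_assoc)
    qed
    then have "induced (x \<otimes>\<^bsub>G\<^esub> y) = induced ?z * induced (y \<otimes>\<^bsub>G\<^esub> x)"
      using cl by (simp add: induced_mult)
    also have "\<dots> = induced (y \<otimes>\<^bsub>G\<^esub> x)"
      unfolding z1 by (rule left_mult_one_mat[OF induced_carrier])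
    finally show ?thesis
      using cl by (simp add: GL_int_def units_of_def ring_mat_simps induced_mult)
  qed
  have va: "virtually_abelian (GL_int (m + m)\<lparr>carrier := induced ` carrier G\<rparr>)"
    using G group_GL_int induced_hom subN fin comm by (rule virtually_abelian_image)
  have "m + m \<ge> 1" using i0(1) by simp
  moreover have "\<forall>x\<in>N. (\<forall>t\<in>carrier G. \<phi> (t \<otimes>\<^bsub>G\<^esub> x \<otimes>\<^bsub>G\<^esub> inv\<^bsub>G\<^esub> t) = 0) \<longrightarrow>
      induced x = \<one>\<^bsub>GL_int (m + m)\<^esub>"
    unfolding one using induced_eq_one by blast
  ultimately show ?thesis
    using inf va induced_hom by blast
qed

section \<open>Lifting in covering spaces\<close>

lemma sheetE:
  assumes y: "y \<in> C" "p y \<in> T"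
    and v: "\<Union>v = C \<inter> p -` T" "\<forall>u\<in>v. openin (top_of_set C) u" "\<forall>u\<in>v. \<exists>q. homeomorphism u T p q"
  obtains u q where "u \<in> v" "y \<in> u" "openin (top_of_set C) u" "homeomorphism u T p q"
proof -
  have "y \<in> \<Union>v" using v(1) y by auto
  then show ?thesis using that v by blast
qed

text \<open>The set where the lifts agree is open and closed in a connected set. Near a point, each
  lift stays in one sheet: in the same sheet they agree because \<open>p\<close> is injective there,
  in different sheets they differ everywhere because sheets are disjoint.\<close>

lemma covering_space_unique_lift:
  assumes cov: "covering_space C p S" and T: "connected T"
    and k: "continuous_on T k" "k ` T \<subseteq> C" and l: "continuous_on T l" "l ` T \<subseteq> C"
    and eq: "\<And>x. x \<in> T \<Longrightarrow> p (k x) = p (l x)"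
    and a: "a \<in> T" "k a = l a" and x: "x \<in> T"
  shows "k x = l x"
proof -
  have local: "\<exists>W. openin (top_of_set T) W \<and> w \<in> W \<and> (\<forall>z\<in>W. (k z = l z) = (k w = l w))"
    if w: "w \<in> T" for w
  proof -
    have "p (k w) \<in> S"
      using covering_space_imp_surjective[OF cov] k(2) w by auto
    then obtain V v where V: "p (k w) \<in> V" and v: "\<Union>v = C \<inter> p -` V" "\<forall>u\<in>v. openin (top_of_set C) u"
        "pairwise disjnt v" "\<forall>u\<in>v. \<exists>q. homeomorphism u V p q"
      using cov unfolding covering_space_def by metis
    have kw: "k w \<in> C" and lw: "l w \<in> C" using k l w by auto
    obtain u q where u: "u \<in> v" "k w \<in> u" "openin (top_of_set C) u" "homeomorphism u V p q"
      using sheetE[OF kw V v(1,2,4)] .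
    obtain u' q' where u': "u' \<in> v" "l w \<in> u'" "openin (top_of_set C) u'" "homeomorphism u' V p q'"
      using sheetE[OF lw _ v(1,2,4)] V eq[OF w] by metis
    let ?W = "(T \<inter> k -` u) \<inter> (T \<inter> l -` u')"
    have "openin (top_of_set T) ?W"
      by (intro openin_Int continuous_openin_preimage[OF k(1) _ u(3)]
          continuous_openin_preimage[OF l(1) _ u'(3)]) (use k l in auto)
    moreover have "k z = l z \<longleftrightarrow> k w = l w" if z: "z \<in> ?W" for z
    proof (cases "u = u'")
      case True
      then have "k z = l z" "k w = l w"
        using homeomorphism_apply1[OF u(4)] eq z w u u' by (metis IntE vimageE)+
      then show ?thesis by simp
    next
      case False
      then have "disjnt u u'" using v(3) u(1) u'(1) by (auto simp: pairwise_def)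
      then show ?thesis using z u(2) u'(2) by (auto simp: disjnt_iff)
    qed
    ultimately show ?thesis using w u u' by blast
  qed
  let ?A = "{x \<in> T. k x = l x}"
  have "openin (top_of_set T) ?A"
  proof (subst openin_subopen, clarify)
    fix w assume "w \<in> T" "k w = l w"
    then obtain W where W: "openin (top_of_set T) W" "w \<in> W" "\<forall>z\<in>W. k z = l z"
      using local by metis
    then have "W \<subseteq> ?A" using openin_imp_subset by blast
    then show "\<exists>W. openin (top_of_set T) W \<and> w \<in> W \<and> W \<subseteq> ?A" using W by blast
  qed
  moreover have "openin (top_of_set T) (T - ?A)"
  proof (subst openin_subopen, rule ballI)
    fix w assume "w \<in> T - ?A"
    then have "w \<in> T" "k w \<noteq> l w" by auto
    then obtain W where W: "openin (top_of_set T) W" "w \<in> W" "\<forall>z\<in>W. k z \<noteq> l z"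
      using local by metis
    then have "W \<subseteq> T - ?A" using openin_imp_subset by blast
    then show "\<exists>W. openin (top_of_set T) W \<and> w \<in> W \<and> W \<subseteq> T - ?A" using W by blast
  qed
  then have "closedin (top_of_set T) ?A"
    by (auto simp: closedin_def)
  ultimately have "?A = {} \<or> ?A = T"
    using T unfolding connected_clopen by blast
  then show ?thesis using a x by blast
qed

text \<open>The initial point \<open>z\<close> and the point \<open>y\<close> above it are both
  arbitrary. Gluing requires this strength: the lift on one piece has to start at a value prescribed
  by the lift on the other, at a point of their common seam.\<close>

definition liftable ::
  "'b::topological_space set \<Rightarrow> ('b \<Rightarrow> 'a::topological_space) \<Rightarrow> ('c::topological_space \<Rightarrow> 'a) \<Rightarrow> 'c set \<Rightarrow> bool"
  where "liftable C p h R \<longleftrightarrow>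
    (\<forall>z\<in>R. \<forall>y\<in>C. p y = h z \<longrightarrow>
       (\<exists>k. continuous_on R k \<and> k ` R \<subseteq> C \<and> (\<forall>w\<in>R. p (k w) = h w) \<and> k z = y))"

lemma liftable_evenly_covered:
  assumes h: "continuous_on R h" "h ` R \<subseteq> V"
    and v: "\<Union>v = C \<inter> p -` V" "\<forall>u\<in>v. openin (top_of_set C) u" "\<forall>u\<in>v. \<exists>q. homeomorphism u V p q"
  shows "liftable C p h R"
  unfolding liftable_def
proof (intro ballI impI)
  fix z y assume z: "z \<in> R" and y: "y \<in> C" "p y = h z"
  have "p y \<in> V" using h z y by auto
  then obtain u q where u: "u \<in> v" "y \<in> u" "openin (top_of_set C) u" "homeomorphism u V p q"
    using sheetE[OF y(1) _ v] by metis
  have qV: "q ` V = u" "continuous_on V q" "\<And>w. w \<in> V \<Longrightarrow> p (q w) = w"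
    using u(4) by (auto simp: homeomorphism_def)
  show "\<exists>k. continuous_on R k \<and> k ` R \<subseteq> C \<and> (\<forall>w\<in>R. p (k w) = h w) \<and> k z = y"
  proof (intro exI[of _ "q \<circ> h"] conjI ballI)
    show "continuous_on R (q \<circ> h)"
      using h qV(2) by (intro continuous_on_compose) (auto intro: continuous_on_subset)
    show "(q \<circ> h) ` R \<subseteq> C"
      using h(2) qV(1) openin_imp_subset[OF u(3)] by fastforce
    show "p ((q \<circ> h) w) = h w" if "w \<in> R" for w
      using qV(3) h(2) that by auto
    show "(q \<circ> h) z = y"
      using homeomorphism_apply1[OF u(4,2)] y by simp
  qed
qed

text \<open>Two lifts that agree at the single point \<open>e\<close> agree on the whole seam,
  because the seam is connected and lifts are unique. Hence the lift defined by cases is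
  continuous.\<close>

lemma liftable_glue:
  fixes f :: "'c::topological_space \<Rightarrow> real"
  assumes cov: "covering_space C p S" and f: "continuous_on R f" and h: "h ` R \<subseteq> S"
    and 1: "liftable C p h {x \<in> R. f x \<le> a}" and 2: "liftable C p h {x \<in> R. a \<le> f x}"
    and conn: "connected {x \<in> R. f x = a}" and ne: "e \<in> R" "f e = a"
  shows "liftable C p h R"
  unfolding liftable_def
proof (intro ballI impI)
  fix z y assume z: "z \<in> R" and y: "y \<in> C" "p y = h z"
  let ?A = "{x \<in> R. f x \<le> a}" and ?B = "{x \<in> R. a \<le> f x}" and ?E = "{x \<in> R. f x = a}"
  have glue: "\<exists>m. continuous_on R m \<and> m ` R \<subseteq> C \<and> (\<forall>w\<in>R. p (m w) = h w) \<and>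
      (\<forall>w\<in>?A. m w = k w) \<and> (\<forall>w\<in>?B. m w = l w)"
    if k: "continuous_on ?A k" "k ` ?A \<subseteq> C" "\<forall>w\<in>?A. p (k w) = h w"
      and l: "continuous_on ?B l" "l ` ?B \<subseteq> C" "\<forall>w\<in>?B. p (l w) = h w" and e: "k e = l e" for k l
  proof -
    have kl: "k w = l w" if "w \<in> ?E" for w
    proof (rule covering_space_unique_lift[OF cov conn, where a=e])
      show "continuous_on ?E k" "continuous_on ?E l"
        by (rule continuous_on_subset[OF k(1)], force, rule continuous_on_subset[OF l(1)], force)
    qed (use k l e ne that in auto)
    let ?m = "\<lambda>x. if f x \<le> a then k x else l x"
    have "continuous_on R ?m"
      using k(1) l(1) f by (rule continuous_on_cases_le) (use kl in auto)
    moreover have "?m w = l w" if "w \<in> ?B" for w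
      using kl[of w] that by auto
    ultimately show ?thesis
      using k l by (intro exI[of _ ?m]) auto
  qed
  have he: "h e \<in> S" using h ne by auto
  show "\<exists>k. continuous_on R k \<and> k ` R \<subseteq> C \<and> (\<forall>w\<in>R. p (k w) = h w) \<and> k z = y"
  proof (cases "f z \<le> a")
    case True
    then obtain k where k: "continuous_on ?A k" "k ` ?A \<subseteq> C" "\<forall>w\<in>?A. p (k w) = h w" "k z = y"
      using 1 z y unfolding liftable_def by blast
    have "e \<in> ?B" "k e \<in> C" "p (k e) = h e" using k ne by auto
    then obtain l where l: "continuous_on ?B l" "l ` ?B \<subseteq> C" "\<forall>w\<in>?B. p (l w) = h w" "l e = k e"
      using 2 unfolding liftable_def by blast
    show ?thesis using glue[OF k(1-3) l(1-3)] l(4) k(4) True z by auto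
  next
    case False
    then have "z \<in> ?B" using z by auto
    then obtain l where l: "continuous_on ?B l" "l ` ?B \<subseteq> C" "\<forall>w\<in>?B. p (l w) = h w" "l z = y"
      using 2 y unfolding liftable_def by blast
    have "e \<in> ?A" "l e \<in> C" "p (l e) = h e" using l ne by auto
    then obtain k where k: "continuous_on ?A k" "k ` ?A \<subseteq> C" "\<forall>w\<in>?A. p (k w) = h w" "k e = l e"
      using 1 unfolding liftable_def by blast
    show ?thesis using glue[OF k(1-3) l(1-3)] l(4) k(4) \<open>z \<in> ?B\<close> by auto
  qed
qed

text \<open>Small rectangles map into evenly covered sets. Interval induction in the second
  coordinate stacks them to strips of full height around each \<open>x\<close>; interval induction
  in the first coordinate glues the strips.\<close>

lemma liftable_square:
  fixes h :: "real \<times> real \<Rightarrow> 'a::topological_space"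
  assumes cov: "covering_space C p S"
    and h: "continuous_on ({0..1} \<times> {0..1}) h" "h ` ({0..1} \<times> {0..1}) \<subseteq> S"
  shows "liftable C p h ({0..1} \<times> {0..1})"
proof -
  \<comment> \<open>The guard is there because the local hypothesis of \<open>Bolzano\<close> also
    speaks of intervals that stick out of the unit interval.\<close>
  define P where "P a b \<longleftrightarrow> (0 \<le> a \<and> b \<le> 1 \<longrightarrow> liftable C p h ({a..b} \<times> {0..1}))" for a b :: real
  have small: "\<exists>d>0. \<forall>c e. c \<le> y \<and> y \<le> e \<and> e - c < d \<longrightarrow> 0 \<le> c \<and> e \<le> 1 \<longrightarrow>
      (\<exists>d>0. \<forall>a b. a \<le> x \<and> x \<le> b \<and> b - a < d \<and> 0 \<le> a \<and> b \<le> 1 \<longrightarrow> liftable C p h ({a..b} \<times> {c..e}))"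
    if xy: "0 \<le> x" "x \<le> 1" "0 \<le> y" "y \<le> 1" for x y :: real
  proof -
    let ?Q = "{0..1} \<times> {0..1} :: (real \<times> real) set"
    have "h (x, y) \<in> S" using h(2) xy by auto
    then obtain V v where V: "h (x, y) \<in> V" "openin (top_of_set S) V" and v: "\<Union>v = C \<inter> p -` V" "\<forall>u\<in>v. openin (top_of_set C) u"
        "pairwise disjnt v" "\<forall>u\<in>v. \<exists>q. homeomorphism u V p q"
      using cov unfolding covering_space_def by metis
    have "openin (top_of_set ?Q) (?Q \<inter> h -` V)"
      using h V(2) by (intro continuous_openin_preimage) auto
    then obtain d where d: "d > 0" "\<And>z. z \<in> ?Q \<Longrightarrow> dist z (x, y) < d \<Longrightarrow> h z \<in> V"
      using V(1) xy unfolding openin_euclidean_subtopology_iff by (metis IntE IntI SigmaI atLeastAtMost_iff vimageE vimageI)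
    \<comment> \<open>Sides shorter than d/2 suffice, since the Euclidean distance is at most the
      sum of the distances of the coordinates.\<close>
    have main: "liftable C p h ({a..b} \<times> {c..e})"
      if "c \<le> y" "y \<le> e" "e - c < d/2" "0 \<le> c" "e \<le> 1" "a \<le> x" "x \<le> b" "b - a < d/2" "0 \<le> a" "b \<le> 1" for a b c e
    proof (rule liftable_evenly_covered[OF _ _ v(1,2,4)])
      have sub: "{a..b} \<times> {c..e} \<subseteq> ?Q" using that by auto
      then show "continuous_on ({a..b} \<times> {c..e}) h" using h(1) continuous_on_subset by blast
      show "h ` ({a..b} \<times> {c..e}) \<subseteq> V"
      proof (clarify)
        fix s t assume st: "s \<in> {a..b}" "t \<in> {c..e}"
        have "dist (s, t) (x, y) \<le> \<bar>s - x\<bar> + \<bar>t - y\<bar>"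
          unfolding dist_Pair_Pair dist_real_def using sqrt_sum_squares_le_sum_abs[of "s - x" "t - y"] by simp
        also have "\<dots> < d" using st that by auto
        finally have "dist (s, t) (x, y) < d" .
        moreover have "(s, t) \<in> ?Q" using sub st by blast
        ultimately show "h (s, t) \<in> V" using d(2) by simp
      qed
    qed
    have "d/2 > 0" using d by simp
    then show ?thesis using main by metis
  qed
  have "P 0 1"
  proof (rule Bolzano[where P=P])
    fix a b c assume P: "P a b" "P b c" "a \<le> b" "b \<le> c"
    show "P a c"
      unfolding P_def
    proof
      assume ac: "0 \<le> a \<and> c \<le> 1"
      have eq: "{x \<in> {a..c} \<times> {0..1}. fst x = b} = {b} \<times> {0..1::real}" using P by auto
      have *: "connected {x \<in> {a..c} \<times> {0..1::real}. fst x = b}"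
        unfolding eq by (intro connected_Times) auto
      have "{x \<in> {a..c} \<times> {0..1}. fst x \<le> b} = {a..b} \<times> {0..1::real}"
        "{x \<in> {a..c} \<times> {0..1}. b \<le> fst x} = {b..c} \<times> {0..1::real}" using P(3,4) by auto
      then show "liftable C p h ({a..c} \<times> {0..1})"
        using P ac h(2)
        by (intro liftable_glue[where f=fst and a=b and e="(b, 0)", OF cov _ _ _ _ *])
          (auto simp: P_def intro!: continuous_intros)
    qed
  next
    fix x :: real assume x: "0 \<le> x" "x \<le> 1"
    \<comment> \<open>The width of the strip may depend on the interval in the second coordinate.
      Gluing two intervals takes the minimum of their widths, and finitely many gluings leave it
      positive.\<close>
    define Q where "Q c e \<longleftrightarrow> (0 \<le> c \<and> e \<le> 1 \<longrightarrow>
      (\<exists>d>0. \<forall>a b. a \<le> x \<and> x \<le> b \<and> b - a < d \<and> 0 \<le> a \<and> b \<le> 1 \<longrightarrow> liftable C p h ({a..b} \<times> {c..e})))" for c e :: real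
    have "Q 0 1"
    proof (rule Bolzano[where P=Q])
      fix c e g assume Q: "Q c e" "Q e g" "c \<le> e" "e \<le> g"
      show "Q c g"
        unfolding Q_def
      proof
        assume cg: "0 \<le> c \<and> g \<le> 1"
        obtain d1 where d1: "d1 > 0" "\<And>a b. a \<le> x \<Longrightarrow> x \<le> b \<Longrightarrow> b - a < d1 \<Longrightarrow> 0 \<le> a \<Longrightarrow> b \<le> 1 \<Longrightarrow> liftable C p h ({a..b} \<times> {c..e})"
          using Q cg by (auto simp: Q_def)
        obtain d2 where d2: "d2 > 0" "\<And>a b. a \<le> x \<Longrightarrow> x \<le> b \<Longrightarrow> b - a < d2 \<Longrightarrow> 0 \<le> a \<Longrightarrow> b \<le> 1 \<Longrightarrow> liftable C p h ({a..b} \<times> {e..g})"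
          using Q cg by (auto simp: Q_def)
        have "liftable C p h ({a..b} \<times> {c..g})"
          if ab: "a \<le> x" "x \<le> b" "b - a < min d1 d2" "0 \<le> a" "b \<le> 1" for a b
        proof -
          have eq: "{x \<in> {a..b} \<times> {c..g}. snd x = e} = {a..b} \<times> {e}" using Q by auto
          have *: "connected {x \<in> {a..b} \<times> {c..g}. snd x = e}"
            unfolding eq by (intro connected_Times) auto
          have "{x \<in> {a..b} \<times> {c..g}. snd x \<le> e} = {a..b} \<times> {c..e}"
            "{x \<in> {a..b} \<times> {c..g}. e \<le> snd x} = {a..b} \<times> {e..g}" using Q(3,4) by auto
          moreover have "h ` ({a..b} \<times> {c..g}) \<subseteq> S"
            using h(2) ab cg by (auto simp: image_subset_iff)
          ultimately show ?thesis
            using Q cg d1(2)[of a b] d2(2)[of a b] ab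
            by (intro liftable_glue[where f=snd and a=e and e="(x, e)", OF cov _ _ _ _ *])
              (auto intro!: continuous_intros)
        qed
        then show "\<exists>d>0. \<forall>a b. a \<le> x \<and> x \<le> b \<and> b - a < d \<and> 0 \<le> a \<and> b \<le> 1 \<longrightarrow> liftable C p h ({a..b} \<times> {c..g})"
          using d1(1) d2(1) by (intro exI[of _ "min d1 d2"]) auto
      qed
    next
      fix y :: real assume "0 \<le> y" "y \<le> 1"
      then show "\<exists>d>0. \<forall>c e. c \<le> y \<and> y \<le> e \<and> e - c < d \<longrightarrow> Q c e"
        unfolding Q_def using small x by blast
    qed simp
    then show "\<exists>d>0. \<forall>a b. a \<le> x \<and> x \<le> b \<and> b - a < d \<longrightarrow> P a b"
      unfolding Q_def P_def by auto
  qed simp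
  then show ?thesis by (simp add: P_def)
qed

text \<open>A path is treated as a map of the square that is constant in the first
  coordinate.\<close>

lemma covering_space_path_lift:
  assumes cov: "covering_space C p S" and g: "path g" "path_image g \<subseteq> S"
    and y: "y \<in> C" "p y = pathstart g"
  obtains k where "path k" "path_image k \<subseteq> C" "pathstart k = y" "\<And>t. t \<in> {0..1} \<Longrightarrow> p (k t) = g t"
proof -
  let ?Q = "{0..1} \<times> {0..1} :: (real \<times> real) set"
  have "continuous_on ?Q (g \<circ> snd)"
    using g(1) by (intro continuous_on_compose continuous_intros) (auto simp: path_def intro: continuous_on_subset)
  moreover have "(g \<circ> snd) ` ?Q \<subseteq> S" using g(2) by (auto simp: path_image_def)
  ultimately have "liftable C p (g \<circ> snd) ?Q" by (rule liftable_square[OF cov])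
  moreover have "(0, 0) \<in> ?Q" "p y = (g \<circ> snd) (0, 0)" using y by (auto simp: pathstart_def)
  ultimately obtain k where k: "continuous_on ?Q k" "k ` ?Q \<subseteq> C" "\<forall>w\<in>?Q. p (k w) = (g \<circ> snd) w" "k (0, 0) = y"
    using y(1) unfolding liftable_def by blast
  show ?thesis
  proof
    show "path (\<lambda>t. k (0, t))"
      unfolding path_def by (rule continuous_on_compose2[OF k(1)]) (auto intro!: continuous_intros)
  qed (use k in \<open>auto simp: path_image_def pathstart_def\<close>)
qed

text \<open>The homotopy is lifted from one corner and its four edges are recognised by uniqueness
  of lifts; the two edges lying over constant paths are constant. This is injectivity of the map on
  fundamental groups, and it makes a function of loops in the cover well defined on
  \<open>cover_subgroup\<close>.\<close>

lemma covering_space_homotopic_lifts: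
  assumes cov: "covering_space C p S"
    and g: "path g1" "path_image g1 \<subseteq> C" "path g2" "path_image g2 \<subseteq> C" "pathstart g1 = pathstart g2"
    and hom: "homotopic_paths S (p \<circ> g1) (p \<circ> g2)"
  shows "homotopic_paths C g1 g2"
proof -
  let ?I = "{0..1} :: real set"
  let ?Q = "?I \<times> ?I"
  obtain h where h: "continuous_on ?Q h" "h \<in> ?Q \<rightarrow> S" "\<And>x. x \<in> ?I \<Longrightarrow> h (0, x) = p (g1 x)"
      "\<And>x. x \<in> ?I \<Longrightarrow> h (1, x) = p (g2 x)"
      "\<And>t. t \<in> ?I \<Longrightarrow> h (t, 0) = p (g1 0)" "\<And>t. t \<in> ?I \<Longrightarrow> h (t, 1) = p (g1 1)"
    using hom unfolding homotopic_paths by (auto simp: pathstart_def pathfinish_def)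
  have "liftable C p h ?Q" using h(1,2) by (intro liftable_square[OF cov]) auto
  moreover have "(0, 0) \<in> ?Q" "g1 0 \<in> C" "p (g1 0) = h (0, 0)" using g h(3) by (auto simp: path_image_def)
  ultimately obtain k where k: "continuous_on ?Q k" "k ` ?Q \<subseteq> C" "\<forall>w\<in>?Q. p (k w) = h w" "k (0, 0) = g1 0"
    unfolding liftable_def by blast
  have edge: "continuous_on ?I (\<lambda>t. k (t, c))" "continuous_on ?I (\<lambda>t. k (c, t))" if "c \<in> ?I" for c
    using that by (auto intro!: continuous_on_compose2[OF k(1)] continuous_intros)
  have g': "continuous_on ?I g1" "g1 ` ?I \<subseteq> C" "continuous_on ?I g2" "g2 ` ?I \<subseteq> C" "g1 0 = g2 0"
    using g by (auto simp: path_def path_image_def pathstart_def)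
  have unique: "l x = m x" if "continuous_on ?I l" "l ` ?I \<subseteq> C" "continuous_on ?I m" "m ` ?I \<subseteq> C"
     "\<And>x. x \<in> ?I \<Longrightarrow> p (l x) = p (m x)" "l 0 = m 0" "x \<in> ?I" for l m x
    using covering_space_unique_lift[OF cov connected_Icc that(1-5) _ that(6,7)] by auto
  have k0: "k (0, x) = g1 x" if "x \<in> ?I" for x
    by (rule unique[OF _ _ _ _ _ _ that]) (use edge g' k h in auto)
  have kl: "k (x, 0) = g1 0" if "x \<in> ?I" for x
    by (rule unique[OF _ _ _ _ _ _ that]) (use edge g' k h in auto)
  have k1: "k (1, x) = g2 x" if "x \<in> ?I" for x
    by (rule unique[OF _ _ _ _ _ _ that]) (use edge g' k h kl in auto)
  have kr: "k (x, 1) = g1 1" if "x \<in> ?I" for x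
    by (rule unique[OF _ _ _ _ _ _ that]) (use edge g' k h k0 in auto)
  show ?thesis
    unfolding homotopic_paths
    by (rule exI[of _ k]) (use k k0 k1 kl kr in \<open>auto simp: pathstart_def pathfinish_def\<close>)
qed

section \<open>The fundamental group\<close>

lemma path_class_eq:
  assumes "homotopic_paths S g h"
  shows "path_class S g = path_class S h"
  unfolding path_class_def using assms homotopic_paths_trans homotopic_paths_sym by blast

lemma path_class_eq_iff:
  assumes "path h" "path_image h \<subseteq> S"
  shows "path_class S g = path_class S h \<longleftrightarrow> homotopic_paths S g h"
proof
  assume "path_class S g = path_class S h"
  moreover have "h \<in> path_class S h" using assms by (simp add: path_class_def)
  ultimately have "h \<in> path_class S g" by simp
  then show "homotopic_paths S g h" by (simp add: path_class_def)
qed (rule path_class_eq)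

lemma path_class_self: "loop_at S x g \<Longrightarrow> g \<in> path_class S g"
  by (simp add: path_class_def loop_at_def)

lemma loop_at_join: "loop_at S x g \<Longrightarrow> loop_at S x h \<Longrightarrow> loop_at S x (g +++ h)"
  by (auto simp: loop_at_def path_image_join)

lemma loop_at_reversepath: "loop_at S x g \<Longrightarrow> loop_at S x (reversepath g)"
  by (auto simp: loop_at_def)

lemma loop_at_const: "x \<in> S \<Longrightarrow> loop_at S x (\<lambda>_. x)"
  by (auto simp: loop_at_def path_def path_image_def pathstart_def pathfinish_def)

lemma loop_at_homotopic: "loop_at S x g \<Longrightarrow> homotopic_paths S g h \<Longrightarrow> loop_at S x h"
  unfolding loop_at_def
  using homotopic_paths_imp_path homotopic_paths_imp_subset homotopic_paths_imp_pathstart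
    homotopic_paths_imp_pathfinish by metis

lemma carrier_fundamental_group [simp]:
  "carrier (fundamental_group S x) = path_class S ` Collect (loop_at S x)"
  by (simp add: fundamental_group_def)

lemma one_fundamental_group [simp]: "\<one>\<^bsub>fundamental_group S x\<^esub> = path_class S (\<lambda>_. x)"
  by (simp add: fundamental_group_def)

lemma fundamental_group_elementE:
  assumes "A \<in> carrier (fundamental_group S x)" "g \<in> A"
  shows "loop_at S x g" "A = path_class S g"
proof -
  obtain h where "loop_at S x h" "A = path_class S h" using assms by auto
  moreover from this have "homotopic_paths S h g" using assms by (simp add: path_class_def)
  ultimately show "loop_at S x g" "A = path_class S g"
    using loop_at_homotopic path_class_eq by blast+
qed

lemma mult_fundamental_group:
  assumes g: "loop_at S x g" and h: "loop_at S x h"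
  shows "path_class S g \<otimes>\<^bsub>fundamental_group S x\<^esub> path_class S h = path_class S (g +++ h)"
proof -
  have "path_class S (g' +++ h') = path_class S (g +++ h)"
    if "g' \<in> path_class S g" "h' \<in> path_class S h" for g' h'
  proof -
    have "homotopic_paths S (g +++ h) (g' +++ h')"
      using that g h by (intro homotopic_paths_join) (auto simp: path_class_def loop_at_def)
    then show ?thesis using path_class_eq by blast
  qed
  moreover have "g \<in> path_class S g" "h \<in> path_class S h"
    using g h by (auto intro: path_class_self)
  ultimately have "(\<Union>g'\<in>path_class S g. \<Union>h'\<in>path_class S h. path_class S (g' +++ h'))
      = path_class S (g +++ h)"
    by blast
  then show ?thesis
    by (simp add: fundamental_group_def)
qed

lemma homotopic_paths_const_join:
  assumes "loop_at S x g"
  shows "homotopic_paths S ((\<lambda>_. x) +++ g) g"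
proof -
  \<comment> \<open>The reparametrization waits at 0 during the first half, where the joined path is
    constant.\<close>
  let ?f = "\<lambda>t::real. max 0 (2 * t - 1)"
  have "homotopic_paths S g ((\<lambda>_. x) +++ g)"
  proof (rule homotopic_paths_reparametrize[where f="?f"])
    show "continuous_on {0..1} ?f" by (intro continuous_intros)
    show "((\<lambda>_. x) +++ g) t = g (?f t)" if "t \<in> {0..1}" for t
      using assms by (cases "t \<le> 1/2") (simp_all add: loop_at_def joinpaths_def pathstart_def)
  qed (use assms in \<open>auto simp: loop_at_def\<close>)
  then show ?thesis by (rule homotopic_paths_sym)
qed

lemma homotopic_paths_reversepath_join:
  assumes g: "loop_at S x g"
  shows "homotopic_paths S (reversepath g +++ g) (\<lambda>_. x)"
proof -
  \<comment> \<open>At stage s the path runs along \<open>g\<close> backwards from parameter 1 only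
    as far as s, rests there, and returns. At s = 1 it does not move at all.\<close>
  let ?k = "\<lambda>z. g (max (fst z) \<bar>2 * snd z - 1\<bar>)"
  have cont: "continuous_on {0..1} g" using g by (auto simp: loop_at_def path_def)
  have im: "g s \<in> S" if "0 \<le> s" "s \<le> 1" for s
    using g that by (auto simp: loop_at_def path_image_def)
  have ends: "g 0 = x" "g 1 = x" using g by (auto simp: loop_at_def pathstart_def pathfinish_def)
  show ?thesis
    unfolding homotopic_paths
  proof (intro exI[of _ ?k] conjI ballI)
    show "continuous_on ({0..1} \<times> {0..1}) ?k"
      by (rule continuous_on_compose2[OF cont]) (auto intro!: continuous_intros)
    show "?k \<in> {0..1} \<times> {0..1} \<rightarrow> S" by (auto intro!: im)
    show "?k (0, t) = (reversepath g +++ g) t" if "t \<in> {0..1}" for t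
    proof -
      have "max 0 \<bar>2 * t - 1\<bar> = (if t \<le> 1/2 then 1 - 2 * t else 2 * t - 1)" by auto
      then show ?thesis by (simp add: joinpaths_def reversepath_def)
    qed
    show "?k (1, t) = x" if "t \<in> {0..1}" for t
      using that ends by (auto simp: max_def abs_if)
  qed (use ends in \<open>auto simp: pathstart_def pathfinish_def reversepath_def joinpaths_def\<close>)
qed

lemma group_fundamental_group:
  assumes "x \<in> S"
  shows "group (fundamental_group S x)"
proof (rule groupI)
  fix A B assume "A \<in> carrier (fundamental_group S x)" "B \<in> carrier (fundamental_group S x)"
  then show "A \<otimes>\<^bsub>fundamental_group S x\<^esub> B \<in> carrier (fundamental_group S x)"
    by (auto simp: mult_fundamental_group intro: loop_at_join)
next
  fix A B C
  assume "A \<in> carrier (fundamental_group S x)" "B \<in> carrier (fundamental_group S x)"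
    "C \<in> carrier (fundamental_group S x)"
  then obtain f g h where fgh: "loop_at S x f" "loop_at S x g" "loop_at S x h"
    "A = path_class S f" "B = path_class S g" "C = path_class S h" by auto
  have "homotopic_paths S (f +++ (g +++ h)) ((f +++ g) +++ h)"
    using fgh by (intro homotopic_paths_assoc) (auto simp: loop_at_def)
  then show "A \<otimes>\<^bsub>fundamental_group S x\<^esub> B \<otimes>\<^bsub>fundamental_group S x\<^esub> C
    = A \<otimes>\<^bsub>fundamental_group S x\<^esub> (B \<otimes>\<^bsub>fundamental_group S x\<^esub> C)"
    using fgh by (simp add: mult_fundamental_group loop_at_join path_class_eq)
next
  fix A assume "A \<in> carrier (fundamental_group S x)"
  then obtain g where g: "loop_at S x g" "A = path_class S g" by auto
  show "\<one>\<^bsub>fundamental_group S x\<^esub> \<otimes>\<^bsub>fundamental_group S x\<^esub> A = A"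
    using g path_class_eq[OF homotopic_paths_const_join[OF g(1)]] loop_at_const[OF assms]
    by (simp add: mult_fundamental_group)
  show "\<exists>B\<in>carrier (fundamental_group S x). B \<otimes>\<^bsub>fundamental_group S x\<^esub> A = \<one>\<^bsub>fundamental_group S x\<^esub>"
    using g path_class_eq[OF homotopic_paths_reversepath_join[OF g(1)]] loop_at_reversepath[OF g(1)]
    by (intro bexI[of _ "path_class S (reversepath g)"]) (auto simp: mult_fundamental_group)
qed (auto intro: loop_at_const assms)

lemma inv_fundamental_group:
  assumes g: "loop_at S x g"
  shows "inv\<^bsub>fundamental_group S x\<^esub> path_class S g = path_class S (reversepath g)"
proof -
  have "x \<in> S" using g by (auto simp: loop_at_def path_image_def pathstart_def)
  then interpret group "fundamental_group S x" by (rule group_fundamental_group)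
  show ?thesis
    using g path_class_eq[OF homotopic_paths_reversepath_join[OF g]] loop_at_reversepath[OF g]
    by (intro inv_equality) (auto simp: mult_fundamental_group)
qed

lemma homotopic_loops_conjugate_gen:
  assumes p: "path p" "path_image p \<subseteq> S" and q: "path q" "path_image q \<subseteq> S"
    and pq: "pathfinish p = pathstart q" "pathfinish q = pathstart q"
  shows "homotopic_loops S (p +++ (q +++ reversepath p)) q"
proof -
  let ?L = "p +++ (q +++ reversepath p)"
  \<comment> \<open>At stage s the long loop is restricted to the parameters from s/2 to 1 - s/4.
    Both ends are the point \<open>p s\<close>, so every stage is closed. At s = 1 the interval is
    [1/2, 3/4], which is where the right-nested join runs through \<open>q\<close>.\<close>
  let ?f = "\<lambda>z :: real \<times> real. (1 - snd z) * (fst z / 2) + snd z * (1 - fst z / 4)"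
  have L: "path ?L" "path_image ?L \<subseteq> S"
    using p q pq by (auto simp: path_image_join)
  have f01: "?f z \<in> {0..1}" if z01: "z \<in> {0..1} \<times> {0..1}" for z
  proof -
    obtain s t where z: "z = (s, t)" "0 \<le> s" "s \<le> 1" "0 \<le> t" "t \<le> 1" using z01 by (cases z) auto
    have "(1 - t) * (s / 2) + t * (1 - s / 4) \<le> 1" using z by (intro convex_bound_le) auto
    then show ?thesis using z by auto
  qed
  show ?thesis
    unfolding homotopic_loops
  proof (intro exI[of _ "?L \<circ> ?f"] conjI ballI)
    show "continuous_on ({0..1} \<times> {0..1}) (?L \<circ> ?f)"
    proof (rule continuous_on_compose)
      show "continuous_on ({0..1} \<times> {0..1}) ?f" by (intro continuous_intros) auto
      show "continuous_on (?f ` ({0..1} \<times> {0..1})) ?L"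
        by (rule continuous_on_subset[OF L(1)[unfolded path_def]]) (intro image_subsetI f01)
    qed
    show "?L \<circ> ?f \<in> {0..1} \<times> {0..1} \<rightarrow> S"
      using L(2) f01 unfolding path_image_def comp_def by (intro funcsetI) blast
    show "(?L \<circ> ?f) (0, t) = ?L t" if "t \<in> {0..1}" for t
      by simp
    show "(?L \<circ> ?f) (1, t) = q t" if "t \<in> {0..1}" for t
    proof -
      have "?f (1, t) = (t + 2) / 4" by (simp add: field_simps)
      then show ?thesis
        using that pq by (auto simp: joinpaths_def pathfinish_def pathstart_def add_divide_distrib)
    qed
    show "pathfinish ((?L \<circ> ?f) \<circ> Pair t) = pathstart ((?L \<circ> ?f) \<circ> Pair t)" if "t \<in> {0..1}" for t
    proof -
      have "?L (1 - t / 4) = reversepath p (1 - t)"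
        using that pq by (cases "t = 1") (auto simp: joinpaths_def pathfinish_def pathstart_def reversepath_def)
      moreover have "?L (t / 2) = p t"
        using that by (simp add: joinpaths_def)
      ultimately show ?thesis
        by (simp add: pathfinish_def pathstart_def reversepath_def)
    qed
  qed
qed

text \<open>Simplicity depends on the free homotopy class of a representing loop, and a conjugate
  loop is freely homotopic to the original one. Nontriviality is preserved by cancellation in the
  group.\<close>

lemma simple_element_conjugate:
  assumes \<gamma>: "simple_element S x \<gamma>" and t: "t \<in> carrier (fundamental_group S x)"
  shows "simple_element S x
    (t \<otimes>\<^bsub>fundamental_group S x\<^esub> \<gamma> \<otimes>\<^bsub>fundamental_group S x\<^esub> inv\<^bsub>fundamental_group S x\<^esub> t)"
proof -
  let ?G = "fundamental_group S x"
  obtain g c where \<gamma>C: "\<gamma> \<in> carrier ?G" and ne: "\<gamma> \<noteq> \<one>\<^bsub>?G\<^esub>" and g: "g \<in> \<gamma>"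
    and c: "simple_closed_curve S c" "homotopic_loops S g c"
    using \<gamma> by (auto simp: simple_element_def)
  have gl: "loop_at S x g" "\<gamma> = path_class S g" using fundamental_group_elementE[OF \<gamma>C g] by auto
  then have "x \<in> S" by (auto simp: loop_at_def path_image_def pathstart_def)
  then interpret group ?G by (rule group_fundamental_group)
  obtain h where h: "loop_at S x h" "t = path_class S h" using t by auto
  let ?l = "h +++ (g +++ reversepath h)"
  have l: "loop_at S x ?l" using h gl by (intro loop_at_join loop_at_reversepath)
  have eq: "t \<otimes>\<^bsub>?G\<^esub> \<gamma> \<otimes>\<^bsub>?G\<^esub> inv\<^bsub>?G\<^esub> t = path_class S ?l"
    using m_assoc[OF t \<gamma>C inv_closed[OF t]] gl h
    by (simp add: inv_fundamental_group mult_fundamental_group loop_at_join loop_at_reversepath)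
  have "homotopic_loops S ?l g"
    using gl(1) h(1) by (intro homotopic_loops_conjugate_gen) (auto simp: loop_at_def)
  then have "homotopic_loops S ?l c" using c(2) homotopic_loops_trans by blast
  moreover have "?l \<in> path_class S ?l" using l by (rule path_class_self)
  moreover have "t \<otimes>\<^bsub>?G\<^esub> \<gamma> \<otimes>\<^bsub>?G\<^esub> inv\<^bsub>?G\<^esub> t \<noteq> \<one>\<^bsub>?G\<^esub>"
  proof
    assume "t \<otimes>\<^bsub>?G\<^esub> \<gamma> \<otimes>\<^bsub>?G\<^esub> inv\<^bsub>?G\<^esub> t = \<one>\<^bsub>?G\<^esub>"
    then have "t \<otimes>\<^bsub>?G\<^esub> \<gamma> = t"
      using t \<gamma>C inv_solve_right[OF one_closed m_closed[OF t \<gamma>C] t] l_one[OF t] by metis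
    then show False using l_cancel_one[OF t \<gamma>C] ne by blast
  qed
  ultimately show ?thesis
    unfolding simple_element_def using c(1) l eq by auto
qed

section \<open>Topology of covers of surfaces\<close>

lemma compact_relative_cover:
  assumes "compact A" "A \<subseteq> X" "\<And>x. x \<in> A \<Longrightarrow> openin (top_of_set X) (W x) \<and> x \<in> W x"
  obtains Z where "Z \<subseteq> A" "finite Z" "A \<subseteq> \<Union>(W ` Z)"
proof -
  have "\<forall>x\<in>A. \<exists>U. open U \<and> W x = X \<inter> U" using assms(3) openin_open by metis
  then obtain U where U: "\<And>x. x \<in> A \<Longrightarrow> open (U x) \<and> W x = X \<inter> U x" by metis
  then have "A \<subseteq> (\<Union>x\<in>A. U x)" using assms(3) by blast
  then obtain Z where "Z \<subseteq> A" "finite Z" "A \<subseteq> (\<Union>x\<in>Z. U x)"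
    using compactE_image[OF assms(1), of A U] U by metis
  then show ?thesis using that[of Z] U assms(2) by blast
qed

text \<open>Over a point with finite fibre, the chosen members of the cover around the fibre points
  already contain the full preimage of a neighbourhood \<open>W\<close>. Finitely many such
  neighbourhoods cover the base, and each contributes finitely many members.\<close>

lemma compact_covering_space:
  assumes cov: "covering_space C p S" and S: "compact S" and fin: "\<forall>x\<in>S. finite {z\<in>C. p z = x}"
  shows "compact C"
proof (rule compactI)
  fix \<U> assume \<U>: "\<forall>U\<in>\<U>. open U" "C \<subseteq> \<Union>\<U>"
  then have "\<forall>z\<in>C. \<exists>U. U \<in> \<U> \<and> z \<in> U" by blast
  from bchoice[OF this] obtain U where U: "\<And>z. z \<in> C \<Longrightarrow> U z \<in> \<U> \<and> z \<in> U z" by blast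
  have "\<exists>W. openin (top_of_set S) W \<and> x \<in> W \<and> C \<inter> p -` W \<subseteq> (\<Union>z\<in>{z\<in>C. p z = x}. U z)"
    if x: "x \<in> S" for x
  proof -
    obtain T v where T: "x \<in> T" "openin (top_of_set S) T" and v: "\<Union>v = C \<inter> p -` T" "\<forall>u\<in>v. openin (top_of_set C) u"
        "pairwise disjnt v" "\<forall>u\<in>v. \<exists>q. homeomorphism u T p q"
      using cov x unfolding covering_space_def by metis
    let ?F = "{z\<in>C. p z = x}"
    have "\<exists>u q. u \<in> v \<and> z \<in> u \<and> homeomorphism u T p q" if "z \<in> ?F" for z
      using that T(1) sheetE[OF _ _ v(1,2,4), of z] by blast
    then obtain u q where uq: "\<And>z. z \<in> ?F \<Longrightarrow> u z \<in> v \<and> z \<in> u z \<and> homeomorphism (u z) T p (q z)"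
      by metis
    define W where "W = (\<Inter>z\<in>?F. T \<inter> q z -` (U z \<inter> C)) \<inter> T"
    have "openin (top_of_set T) (T \<inter> q z -` (U z \<inter> C))" if z: "z \<in> ?F" for z
    proof (rule continuous_openin_preimage)
      show "continuous_on T (q z)" using uq[OF z] by (auto simp: homeomorphism_def)
      show "q z \<in> T \<rightarrow> C" using uq[OF z] v(1) by (fastforce simp: homeomorphism_def)
      show "openin (top_of_set C) (U z \<inter> C)"
        using U[of z] \<U>(1) z by (simp add: openin_open_Int Int_commute)
    qed
    then have "openin (top_of_set T) ((\<Inter>z\<in>?F. T \<inter> q z -` (U z \<inter> C)) \<inter> topspace (top_of_set T))"
      using fin x by (intro openin_INT) auto
    then have "openin (top_of_set T) W"
      unfolding W_def by (simp only: topspace_euclidean_subtopology)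
    then have "openin (top_of_set S) W" using T(2) openin_trans by blast
    moreover have "x \<in> W"
      unfolding W_def
    proof (intro IntI INT_I vimageI2)
      fix z assume z: "z \<in> ?F"
      then have "q z x = z" using uq[OF z] homeomorphism_apply1 by blast
      then show "q z x \<in> U z" "q z x \<in> C" using U z by auto
    qed (use T(1) in auto)
    \<comment> \<open>The sheet through \<open>w\<close> contains exactly one fibre point over
      \<open>x\<close>, hence is the sheet chosen for that point. Its local inverse returns
      \<open>w\<close> from \<open>p w\<close>, and by the choice of \<open>W\<close> it takes
      values in the chosen open set.\<close>
    moreover have "w \<in> (\<Union>z\<in>?F. U z)" if w: "w \<in> C" "p w \<in> W" for w
    proof -
      have "p w \<in> T" using w(2) by (simp add: W_def)
      then obtain u' q' where u': "u' \<in> v" "w \<in> u'" "homeomorphism u' T p q'"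
        using sheetE[OF w(1) _ v(1,2,4)] by metis
      have z: "q' x \<in> u'" "p (q' x) = x" using u'(3) T(1) by (auto simp: homeomorphism_def)
      then have zF: "q' x \<in> ?F" using u'(1) v(1) by auto
      have "\<not> disjnt u' (u (q' x))" using z uq[OF zF] by (auto simp: disjnt_iff)
      then have "u (q' x) = u'" using v(3) u'(1) uq[OF zF] by (auto simp: pairwise_def)
      then have "q (q' x) (p w) = w" using uq[OF zF] u'(2) by (metis homeomorphism_apply1)
      moreover have "q (q' x) (p w) \<in> U (q' x)" using w(2) zF unfolding W_def by blast
      ultimately show ?thesis using zF by auto
    qed
    ultimately show ?thesis by (intro exI[of _ W]) auto
  qed
  then obtain W where W: "\<And>x. x \<in> S \<Longrightarrow> openin (top_of_set S) (W x) \<and> x \<in> W x"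
      "\<And>x. x \<in> S \<Longrightarrow> C \<inter> p -` W x \<subseteq> (\<Union>z\<in>{z\<in>C. p z = x}. U z)" by metis
  obtain Z where Z: "Z \<subseteq> S" "finite Z" "S \<subseteq> \<Union>(W ` Z)"
    using compact_relative_cover[OF S subset_refl W(1)] by metis
  let ?D = "\<Union>x\<in>Z. U ` {z\<in>C. p z = x}"
  have "?D \<subseteq> \<U>" using U by auto
  moreover have "finite ?D" using Z fin by auto
  moreover have "C \<subseteq> \<Union>?D"
  proof
    fix w assume w: "w \<in> C"
    then have "p w \<in> S" using covering_space_imp_surjective[OF cov] by auto
    then obtain x where "x \<in> Z" "p w \<in> W x" using Z(3) by auto
    then show "w \<in> \<Union>?D" using W(2)[of x] Z(1) w by auto
  qed
  ultimately show "\<exists>D\<subseteq>\<U>. finite D \<and> C \<subseteq> \<Union>D" by blast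
qed

text \<open>Points of different fibres are separated by preimages from the base, points of the same
  fibre by their sheets.\<close>

lemma Hausdorff_covering_space:
  assumes cov: "covering_space C p S" and S: "Hausdorff_space (top_of_set S)"
  shows "Hausdorff_space (top_of_set C)"
  unfolding Hausdorff_space_def
proof (intro allI impI)
  fix y z assume "y \<in> topspace (top_of_set C) \<and> z \<in> topspace (top_of_set C) \<and> y \<noteq> z"
  then have yz: "y \<in> C" "z \<in> C" "y \<noteq> z" by auto
  have pS: "p y \<in> S" "p z \<in> S" using covering_space_imp_surjective[OF cov] yz by auto
  have preimage: "openin (top_of_set C) (C \<inter> p -` U)" if "openin (top_of_set S) U" for U
    using cov that by (intro continuous_openin_preimage) (auto simp: covering_space_def)
  show "\<exists>U V. openin (top_of_set C) U \<and> openin (top_of_set C) V \<and> y \<in> U \<and> z \<in> V \<and> disjnt U V"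
  proof (cases "p y = p z")
    case False
    then obtain U V where UV: "openin (top_of_set S) U" "openin (top_of_set S) V" "p y \<in> U" "p z \<in> V" "disjnt U V"
      using S[unfolded Hausdorff_space_def, rule_format, of "p y" "p z"] pS by auto
    then show ?thesis using preimage yz
      by (intro exI[of _ "C \<inter> p -` U"] exI[of _ "C \<inter> p -` V"]) (auto simp: disjnt_iff)
  next
    case True
    obtain T v where T: "p y \<in> T" and v: "\<Union>v = C \<inter> p -` T" "\<forall>u\<in>v. openin (top_of_set C) u"
        "pairwise disjnt v" "\<forall>u\<in>v. \<exists>q. homeomorphism u T p q"
      using cov pS(1) unfolding covering_space_def by metis
    obtain u q where u: "u \<in> v" "y \<in> u" "homeomorphism u T p q"
      using sheetE[OF yz(1) T v(1,2,4)] by metis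
    obtain u' q' where u': "u' \<in> v" "z \<in> u'" "homeomorphism u' T p q'"
      using sheetE[OF yz(2) _ v(1,2,4)] T True by metis
    have "u \<noteq> u'" using homeomorphism_apply1[OF u(3)] u u' True yz(3) by metis
    then have "disjnt u u'" using v(3) u(1) u'(1) by (auto simp: pairwise_def)
    then show ?thesis using u u' v(2) by blast
  qed
qed

text \<open>The local model is chosen compact and convex, so that one notion yields local compactness,
  local path connectedness and local simple connectedness.\<close>

definition cell :: "'a::topological_space set \<Rightarrow> bool" where
  "cell K \<longleftrightarrow> (\<exists>(C::complex set) f g. convex C \<and> compact C \<and> homeomorphism C K f g)"

section \<open>Cells in surfaces and in their covers\<close>

lemma cell_compact: "cell K \<Longrightarrow> compact K"
  unfolding cell_def homeomorphism_def using compact_continuous_image by blast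

lemma cell_path_connected: "cell K \<Longrightarrow> path_connected K"
  unfolding cell_def homeomorphism_def
  using path_connected_continuous_image convex_imp_path_connected by metis

text \<open>A closed ball cut with the half plane is compact and convex whether or not its centre is
  on the boundary line, so interior and boundary points are treated alike.\<close>

lemma locally_cell_half_plane:
  assumes V: "openin (top_of_set {z::complex. Im z \<ge> 0}) V"
  shows "locally cell V"
proof (rule locallyI)
  let ?H = "{z::complex. Im z \<ge> 0}"
  fix w x assume w: "openin (top_of_set V) w" and x: "x \<in> w"
  have wH: "openin (top_of_set ?H) w" using V w openin_trans by blast
  then obtain e where e: "e > 0" "cball x e \<inter> ?H \<subseteq> w"
    using x unfolding openin_contains_cball by metis
  have wV: "w \<subseteq> V" using w openin_imp_subset by blast
  have VH: "V \<subseteq> ?H" using V openin_imp_subset by blast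
  show "\<exists>U K. openin (top_of_set V) U \<and> cell K \<and> x \<in> U \<and> U \<subseteq> K \<and> K \<subseteq> w"
  proof (intro exI conjI)
    show "openin (top_of_set V) (V \<inter> ball x e)" by (rule openin_open_Int) simp
    have "closed ?H" "convex ?H" by (simp_all add: closed_halfspace_Im_ge convex_halfspace_Im_ge)
    then have "compact (cball x e \<inter> ?H)" "convex (cball x e \<inter> ?H)"
      by (auto intro: compact_Int_closed convex_Int)
    then show "cell (cball x e \<inter> ?H)"
      unfolding cell_def using homeomorphism_ident by blast
  qed (use e x wV VH in auto)
qed

lemma locally_cell_homeomorphism:
  assumes hom: "homeomorphism A B f g" and A: "locally cell A"
  shows "locally cell B"
proof (rule locallyI)
  fix w x assume w: "openin (top_of_set B) w" and x: "x \<in> w"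
  have fg: "f ` A = B" "g ` B = A" "\<And>a. a \<in> A \<Longrightarrow> g (f a) = a" "\<And>b. b \<in> B \<Longrightarrow> f (g b) = b"
    "continuous_on A f" "continuous_on B g"
    using hom by (auto simp: homeomorphism_def)
  have xB: "x \<in> B" using w x openin_imp_subset by blast
  have op: "openin (top_of_set A) (A \<inter> f -` w)"
    using fg w by (intro continuous_openin_preimage) auto
  have mem: "g x \<in> A \<inter> f -` w" using fg x xB by auto
  obtain U K where UK: "openin (top_of_set A) U" "cell K" "g x \<in> U" "U \<subseteq> K" "K \<subseteq> A \<inter> f -` w"
    using locallyE[OF A op mem] .
  obtain C :: "complex set" and k l where C: "convex C" "compact C" "homeomorphism C K k l"
    using UK(2) by (auto simp: cell_def)
  have "openin (top_of_set B) (B \<inter> g -` U)"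
    using fg UK(1) by (intro continuous_openin_preimage) auto
  moreover have "homeomorphism K (f ` K) f g"
    using hom UK(5) by (auto intro: homeomorphism_of_subsets)
  then have "cell (f ` K)"
    unfolding cell_def using C homeomorphism_compose by blast
  moreover have "x \<in> B \<inter> g -` U" using UK xB by auto
  moreover have "B \<inter> g -` U \<subseteq> f ` K" using fg UK(4) by force
  moreover have "f ` K \<subseteq> w" using UK(5) by auto
  ultimately show "\<exists>U K. openin (top_of_set B) U \<and> cell K \<and> x \<in> U \<and> U \<subseteq> K \<and> K \<subseteq> w" by blast
qed

lemma locally_if_open_cover:
  assumes "\<And>x. x \<in> X \<Longrightarrow> \<exists>U. openin (top_of_set X) U \<and> x \<in> U \<and> locally P U"
  shows "locally P X"
proof (rule locallyI)
  fix w x assume w: "openin (top_of_set X) w" "x \<in> w"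
  then have "x \<in> X" using openin_imp_subset by blast
  then obtain U where U: "openin (top_of_set X) U" "x \<in> U" "locally P U" using assms by blast
  have op: "openin (top_of_set U) (U \<inter> w)"
    using U(1) w(1) by (meson Int_lower1 openin_Int openin_imp_subset openin_subset_trans)
  have mem: "x \<in> U \<inter> w" using U(2) w(2) by blast
  obtain V K where VK: "openin (top_of_set U) V" "P K" "x \<in> V" "V \<subseteq> K" "K \<subseteq> U \<inter> w"
    using locallyE[OF U(3) op mem] .
  then show "\<exists>V K. openin (top_of_set X) V \<and> P K \<and> x \<in> V \<and> V \<subseteq> K \<and> K \<subseteq> w"
    using openin_trans[OF VK(1) U(1)] by blast
qed

lemma locally_cell_surface:
  assumes "surface S"
  shows "locally cell S"
proof (rule locally_if_open_cover)
  fix x assume "x \<in> S"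
  then obtain U V where UV: "x \<in> U" "openin (top_of_set S) U"
      "openin (top_of_set {z::complex. Im z \<ge> 0}) V" "U homeomorphic V"
    using assms unfolding surface_def by blast
  then obtain f g where "homeomorphism U V f g"
    by (auto simp: homeomorphic_def)
  from locally_cell_homeomorphism[OF homeomorphism_symD[OF this] locally_cell_half_plane[OF UV(3)]]
  show "\<exists>U. openin (top_of_set S) U \<and> x \<in> U \<and> locally cell U"
    using UV(1,2) by blast
qed

lemma locally_cell_covering_space:
  assumes cov: "covering_space C p S" and S: "locally cell S"
  shows "locally cell C"
proof (rule locally_if_open_cover)
  fix y assume "y \<in> C"
  then obtain T u q where T: "y \<in> T" "openin (top_of_set C) T" "p y \<in> u" "openin (top_of_set S) u"
      "homeomorphism T u p q"
    using covering_space_local_homeomorphism[OF cov] by metis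
  have "locally cell u" using S T(4) by (rule locally_open_subset)
  with homeomorphism_symD[OF T(5)] have "locally cell T"
    by (rule locally_cell_homeomorphism)
  then show "\<exists>U. openin (top_of_set C) U \<and> y \<in> U \<and> locally cell U" using T by blast
qed

lemma connected_locally_cell_imp_path_connected:
  assumes "connected X" "locally cell X"
  shows "path_connected X"
proof -
  have "locally path_connected X" using assms(2) cell_path_connected locally_mono by blast
  then show ?thesis
    using assms(1) path_component_eq_connected_component
    by (metis connected_iff_connected_component path_connected_component)
qed

section \<open>Additive functions of paths\<close>

text \<open>A closed 1-cochain evaluated on paths. \<open>cong\<close> reflects that a path is a
  function on all reals of which only the values on the unit interval count. \<open>triangle\<close>
  is the cocycle condition for straight triangles in a mapped square; degenerate ones are
  allowed.\<close>

locale path_cocycle =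
  fixes X :: "'b::topological_space set" and F :: "(real \<Rightarrow> 'b) \<Rightarrow> rat"
  assumes cong: "\<And>g h. (\<And>t. t \<in> {0..1} \<Longrightarrow> g t = h t) \<Longrightarrow> F g = F h"
    and triangle: "\<And>(h::real \<times> real \<Rightarrow> 'b) a b c. continuous_on ({0..1} \<times> {0..1}) h \<Longrightarrow>
      h ` ({0..1} \<times> {0..1}) \<subseteq> X \<Longrightarrow> a \<in> {0..1} \<times> {0..1} \<Longrightarrow> b \<in> {0..1} \<times> {0..1} \<Longrightarrow>
      c \<in> {0..1} \<times> {0..1} \<Longrightarrow> F (h \<circ> linepath a b) + F (h \<circ> linepath b c) = F (h \<circ> linepath a c)"
begin

text \<open>A degenerate triangle, obtained by letting the path depend on the first coordinate of
  the square only. The parameters may come in any order, which yields the rule for reversed paths as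
  well as that for joins.\<close>

lemma subpaths:
  assumes g: "path g" "path_image g \<subseteq> X" and uvw: "u \<in> {0..1}" "v \<in> {0..1}" "w \<in> {0..1}"
  shows "F (g \<circ> linepath u v) + F (g \<circ> linepath v w) = F (g \<circ> linepath u w)"
proof -
  have *: "(g \<circ> fst) \<circ> linepath (a, 0) (b, 0) = g \<circ> linepath a b" for a b :: real
    by (auto simp: linepath_def)
  have "continuous_on ({0..1::real} \<times> {0..1::real}) (g \<circ> fst)"
    using g(1) unfolding path_def by (intro continuous_on_compose continuous_intros) simp
  moreover have "(g \<circ> fst) ` ({0..1::real} \<times> {0..1::real}) \<subseteq> X" using g(2) by (auto simp: path_image_def)
  ultimately show ?thesis
    using triangle[of "g \<circ> fst" "(u, 0)" "(v, 0)" "(w, 0)"] uvw unfolding * by simp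
qed

lemma const: "x \<in> X \<Longrightarrow> F (\<lambda>_. x) = 0"
  using triangle[of "\<lambda>_. x" "(0, 0)" "(0, 0)" "(0, 0)"] by (auto simp: comp_def)

lemma join:
  assumes g: "path g" "path_image g \<subseteq> X" and k: "path k" "path_image k \<subseteq> X"
    and "pathfinish g = pathstart k"
  shows "F (g +++ k) = F g + F k"
proof -
  have "F ((g +++ k) \<circ> linepath 0 (1/2)) = F g"
    by (rule cong) (auto simp: joinpaths_def)
  moreover have "F ((g +++ k) \<circ> linepath (1/2) 1) = F k"
  proof (rule cong)
    fix t :: real assume "t \<in> {0..1}"
    then show "((g +++ k) \<circ> linepath (1/2) 1) t = k t"
      using assms(5) by (cases "t = 0")
        (auto simp: joinpaths_def linepath_def pathfinish_def pathstart_def field_simps)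
  qed
  moreover have "F ((g +++ k) \<circ> linepath 0 1) = F (g +++ k)"
    by (rule cong) simp
  moreover have "path (g +++ k)" "path_image (g +++ k) \<subseteq> X"
    using assms by (auto simp: path_image_join)
  ultimately show ?thesis using subpaths[of "g +++ k" 0 "1/2" 1] by simp
qed

lemma reverse:
  assumes g: "path g" "path_image g \<subseteq> X"
  shows "F (reversepath g) = - F g"
proof -
  have "F (g \<circ> linepath 0 1) = F g" by (rule cong) simp
  moreover have "F (g \<circ> linepath 1 0) = F (reversepath g)"
    by (rule cong) (simp add: reversepath_def linepath_def)
  moreover have "F (g \<circ> linepath 0 0) = 0"
  proof -
    have "g \<circ> linepath 0 0 = (\<lambda>_. g 0)" by (auto simp: linepath_def)
    moreover have "g 0 \<in> X" using g(2) by (auto simp: path_image_def)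
    ultimately show ?thesis using const by simp
  qed
  ultimately show ?thesis using subpaths[OF g, of 0 1 0] by simp
qed

text \<open>The two triangles of the homotopy square share the diagonal. The remaining pair of
  opposite edges are constant paths, on which \<open>F\<close> vanishes.\<close>

lemma homotopic:
  assumes "homotopic_paths X g k"
  shows "F g = F k"
proof -
  let ?I = "{0..1} :: real set"
  obtain h where h: "continuous_on (?I \<times> ?I) h" "h \<in> ?I \<times> ?I \<rightarrow> X" "\<And>x. x \<in> ?I \<Longrightarrow> h (0, x) = g x"
      "\<And>x. x \<in> ?I \<Longrightarrow> h (1, x) = k x"
      "\<And>t. t \<in> ?I \<Longrightarrow> h (t, 0) = g 0" "\<And>t. t \<in> ?I \<Longrightarrow> h (t, 1) = g 1"
    using assms unfolding homotopic_paths by (auto simp: pathstart_def pathfinish_def)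
  have im: "h ` (?I \<times> ?I) \<subseteq> X" using h(2) by auto
  note tri = triangle[OF h(1) im]
  have X: "g 0 \<in> X" "g 1 \<in> X"
    using homotopic_paths_imp_subset[OF assms] by (auto simp: path_image_def)
  have "F (h \<circ> linepath (0, 0) (0, 1)) = F g" by (rule cong) (simp add: linepath_def h)
  moreover have "F (h \<circ> linepath (1, 0) (1, 1)) = F k" by (rule cong) (simp add: linepath_def h)
  moreover have "F (h \<circ> linepath (0, 0) (1, 0)) = F (\<lambda>_. g 0)" by (rule cong) (simp add: linepath_def h)
  moreover have "F (h \<circ> linepath (0, 1) (1, 1)) = F (\<lambda>_. g 1)" by (rule cong) (simp add: linepath_def h)
  ultimately show ?thesis
    using tri[of "(0, 0)" "(0, 1)" "(1, 1)"] tri[of "(0, 0)" "(1, 0)" "(1, 1)"] X const by simp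
qed

text \<open>The primitive integrates \<open>F\<close> along segments from a fixed point of the convex model;
  the cone over a path compares the two.\<close>

lemma cell_primitive:
  assumes K: "cell K" "K \<subseteq> X"
  obtains P where "\<And>g. path g \<Longrightarrow> path_image g \<subseteq> K \<Longrightarrow> F g = P (g 1) - P (g 0)"
proof (cases "K = {}")
  case True
  then show ?thesis using that[of "\<lambda>_. 0"] by (auto simp: path_image_def)
next
  case False
  obtain C :: "complex set" and f l where C: "convex C" and hom: "homeomorphism C K f l"
    using K(1) by (auto simp: cell_def)
  have fl: "f ` C = K" "l ` K = C" "\<And>x. x \<in> K \<Longrightarrow> f (l x) = x" "continuous_on C f" "continuous_on K l"
    using hom by (auto simp: homeomorphism_def)
  obtain c where c: "c \<in> C" using False fl(1) by auto
  show ?thesis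
  proof (rule that[of "\<lambda>x. F (f \<circ> linepath c (l x))"])
    fix g assume g: "path g" "path_image g \<subseteq> K"
    let ?Q = "{0..1} \<times> {0..1} :: (real \<times> real) set"
    let ?k = "l \<circ> g"
    let ?H = "\<lambda>z. (1 - fst z) *\<^sub>R c + fst z *\<^sub>R ?k (snd z)"
    have gK: "g t \<in> K" if "t \<in> {0..1}" for t using g(2) that by (auto simp: path_image_def)
    have kC: "?k t \<in> C" if "t \<in> {0..1}" for t using gK[OF that] fl(2) by auto
    have HC: "?H z \<in> C" if "z \<in> ?Q" for z
      using that kC c C by (intro convexD[OF C]) auto
    have "continuous_on {0..1} ?k"
      using g fl(5) unfolding path_def path_image_def
      by (intro continuous_on_compose) (auto intro: continuous_on_subset)
    then have "continuous_on ?Q (\<lambda>z. ?k (snd z))"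
      by (rule continuous_on_compose2) (auto intro!: continuous_intros)
    then have "continuous_on ?Q ?H" by (intro continuous_intros)
    then have cont: "continuous_on ?Q (f \<circ> ?H)"
      by (rule continuous_on_compose) (rule continuous_on_subset[OF fl(4)], intro image_subsetI HC)
    have im: "(f \<circ> ?H) ` ?Q \<subseteq> X" using HC fl(1) K(2) by (auto simp: image_subset_iff)
    note tri = triangle[OF cont im]
    have "F ((f \<circ> ?H) \<circ> linepath (0, 0) (1, 0)) = F (f \<circ> linepath c (l (g 0)))"
      by (rule cong) (simp add: linepath_def)
    moreover have "F ((f \<circ> ?H) \<circ> linepath (0, 1) (1, 1)) = F (f \<circ> linepath c (l (g 1)))"
      by (rule cong) (simp add: linepath_def)
    moreover have "F ((f \<circ> ?H) \<circ> linepath (1, 0) (1, 1)) = F g"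
      by (rule cong) (use gK fl(3) in \<open>simp add: linepath_def\<close>)
    moreover have "F ((f \<circ> ?H) \<circ> linepath (0, 0) (0, 1)) = F (\<lambda>_. f c)"
      by (rule cong) (simp add: linepath_def)
    moreover have "F (\<lambda>_. f c) = 0" using c fl(1) K(2) by (intro const) auto
    ultimately show "F g = F (f \<circ> linepath c (l (g 1))) - F (f \<circ> linepath c (l (g 0)))"
      using tri[of "(0, 0)" "(1, 0)" "(1, 1)"] tri[of "(0, 0)" "(0, 1)" "(1, 1)"] by simp
  qed
qed

end

lemma common_denominator:
  assumes "finite (A :: rat set)"
  obtains m :: int where "m > 0" "\<And>q. q \<in> A \<Longrightarrow> of_int m * q \<in> \<int>"
  using assms
proof (induction A arbitrary: thesis rule: finite_induct)
  case empty
  show ?case by (rule empty[of 1]) auto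
next
  case (insert q A)
  obtain m :: int where m: "m > 0" "\<And>q. q \<in> A \<Longrightarrow> of_int m * q \<in> \<int>" using insert.IH by blast
  obtain a b where ab: "quotient_of q = (a, b)" by force
  have b: "b > 0" "q = of_int a / of_int b"
    using ab by (auto dest: quotient_of_denom_pos quotient_of_div)
  show ?case
  proof (rule insert.prems[of "m * b"])
    show "m * b > 0" using m b by simp
    fix r assume "r \<in> insert q A"
    then show "of_int (m * b) * r \<in> \<int>"
    proof
      assume "r = q"
      then have "of_int (m * b) * r = of_int (m * a)" using b by simp
      then show ?thesis by (metis Ints_of_int)
    next
      assume "r \<in> A"
      then have "of_int b * (of_int m * r) \<in> \<int>" using Ints_mult[OF Ints_of_int m(2)] by blast
      then show ?thesis by (simp add: ac_simps)
    qed
  qed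
qed

text \<open>Cover \<open>X\<close> by finitely many compact sets inside open sets on which \<open>F\<close> has a primitive.  On an
  overlap two primitives differ by a locally constant function, which takes finitely many values;
  the value of \<open>F\<close> on a loop is a sum of such differences.\<close>

theorem (in path_cocycle) bounded_denominators:
  assumes X: "compact X" "Hausdorff_space (top_of_set X)" "locally cell X"
  obtains m :: int where "m > 0"
    "\<And>g. path g \<Longrightarrow> path_image g \<subseteq> X \<Longrightarrow> pathfinish g = pathstart g \<Longrightarrow> of_int m * F g \<in> \<int>"
proof -
  have "\<exists>V K W P. openin (top_of_set X) V \<and> z \<in> V \<and> V \<subseteq> K \<and> compact K \<and> K \<subseteq> W \<and> openin (top_of_set X) W \<and>
      (\<forall>g. path g \<and> path_image g \<subseteq> W \<longrightarrow> F g = P (g 1) - P (g 0))" if z: "z \<in> X" for z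
  proof -
    obtain W L where W: "openin (top_of_set X) W" "cell L" "z \<in> W" "W \<subseteq> L" "L \<subseteq> X"
      using locallyE[OF X(3) openin_subtopology_self z] .
    obtain P where P: "\<And>g. path g \<Longrightarrow> path_image g \<subseteq> L \<Longrightarrow> F g = P (g 1) - P (g 0)"
      using cell_primitive[OF W(2,5)] by blast
    \<comment> \<open>A second cell, inside \<open>W\<close>. Compactness of \<open>K\<close> will
      leave only finitely many transition constants, while openness of \<open>W\<close> leaves room
      for the paths used to compare primitives.\<close>
    obtain V K where V: "openin (top_of_set X) V" "cell K" "z \<in> V" "V \<subseteq> K" "K \<subseteq> W"
      using locallyE[OF X(3) W(1,3)] .
    have "F g = P (g 1) - P (g 0)" if "path g" "path_image g \<subseteq> W" for g
      using P that W(4) by (meson subset_trans)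
    then show ?thesis using V W cell_compact[OF V(2)] by blast
  qed
  then obtain V K W P where VKW: "\<And>z. z \<in> X \<Longrightarrow> openin (top_of_set X) (V z) \<and> z \<in> V z \<and> V z \<subseteq> K z \<and>
      compact (K z) \<and> K z \<subseteq> W z \<and> openin (top_of_set X) (W z) \<and>
      (\<forall>g. path g \<and> path_image g \<subseteq> W z \<longrightarrow> F g = P z (g 1) - P z (g 0))" by metis
  obtain Z where Z: "Z \<subseteq> X" "finite Z" "X \<subseteq> \<Union>(V ` Z)"
    using compact_relative_cover[OF X(1) subset_refl, of V] VKW by metis
  have VKW': "openin (top_of_set X) (V i) \<and> V i \<subseteq> K i \<and> compact (K i) \<and> K i \<subseteq> W i \<and>
      openin (top_of_set X) (W i)"
    and prim: "\<And>g. path g \<Longrightarrow> path_image g \<subseteq> W i \<Longrightarrow> F g = P i (g 1) - P i (g 0)"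
    if "i \<in> Z" for i
    using VKW[of i] that Z(1) by auto
  have opV: "openin (top_of_set X) (V i)" and opW: "openin (top_of_set X) (W i)"
    and compK: "compact (K i)" and VK: "V i \<subseteq> K i" and KW: "K i \<subseteq> W i" if "i \<in> Z" for i
    using VKW'[OF that] by auto
  have KX: "K i \<subseteq> X" if "i \<in> Z" for i
    using KW[OF that] openin_imp_subset[OF opW[OF that]] by (rule subset_trans)
  have "finite ((\<lambda>x. P i x - P j x) ` (K i \<inter> K j))" if ij: "i \<in> Z" "j \<in> Z" for i j
  proof -
    \<comment> \<open>Hausdorffness enters here: it makes \<open>K i\<close> closed, so that the
      intersection of two compact sets is compact.\<close>
    have KK: "compact (K i \<inter> K j)"
    proof -
      have "closedin (top_of_set X) (K i)"
        using compK[OF ij(1)] KX[OF ij(1)] X(2)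
        by (intro compactin_imp_closedin) (auto simp: compactin_subtopology)
      then obtain T where T: "closed T" "K i = X \<inter> T" by (auto simp: closedin_closed)
      then have "K i \<inter> K j = K j \<inter> T" using KX[OF ij(2)] by auto
      then show ?thesis using compact_Int_closed[OF compK[OF ij(2)] T(1)] by simp
    qed
    \<comment> \<open>A cell inside both domains joins \<open>x\<close> to each nearby
      \<open>y\<close> by a path, and the two primitives compute the same value of \<open>F\<close>
      on it.\<close>
    have ex: "\<exists>U. openin (top_of_set X) U \<and> x \<in> U \<and> (\<forall>y\<in>U. P i y - P j y = P i x - P j x)"
      if x: "x \<in> K i \<inter> K j" for x
    proof -
      have op: "openin (top_of_set X) (W i \<inter> W j)" using ij opW by (intro openin_Int)
      have mem: "x \<in> W i \<inter> W j" using KW ij x by blast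
      obtain U N where U: "openin (top_of_set X) U" "cell N" "x \<in> U" "U \<subseteq> N" "N \<subseteq> W i \<inter> W j"
        using locallyE[OF X(3) op mem] .
      have eq: "P i y - P j y = P i x - P j x" if y: "y \<in> U" for y
      proof -
        have N: "x \<in> N" "y \<in> N" using U(3,4) y by auto
        obtain g where g: "path g" "path_image g \<subseteq> N" "pathstart g = x" "pathfinish g = y"
          using cell_path_connected[OF U(2), unfolded path_connected_def, rule_format, OF N] by blast
        have sub: "path_image g \<subseteq> W i" "path_image g \<subseteq> W j" using g(2) U(5) by auto
        have "P i y - P i x = P j y - P j x"
          using prim[OF ij(1) g(1) sub(1)] prim[OF ij(2) g(1) sub(2)] g(3,4)
          by (simp add: pathstart_def pathfinish_def)
        then show ?thesis by simp
      qed
      show ?thesis by (intro exI[of _ U] conjI ballI U(1) U(3) eq)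
    qed
    then obtain U where U: "\<And>x. x \<in> K i \<inter> K j \<Longrightarrow> openin (top_of_set X) (U x) \<and> x \<in> U x"
      "\<And>x y. x \<in> K i \<inter> K j \<Longrightarrow> y \<in> U x \<Longrightarrow> P i y - P j y = P i x - P j x" by metis
    have "K i \<inter> K j \<subseteq> X" using KX[OF ij(1)] by blast
    then obtain Y where Y: "Y \<subseteq> K i \<inter> K j" "finite Y" "K i \<inter> K j \<subseteq> \<Union>(U ` Y)"
      using compact_relative_cover[OF KK, of X U] U(1) by metis
    then have "(\<lambda>x. P i x - P j x) ` (K i \<inter> K j) \<subseteq> (\<lambda>x. P i x - P j x) ` Y"
      using U(2) by blast
    then show ?thesis using Y(2) finite_subset by blast
  qed
  then have "finite (\<Union>i\<in>Z. \<Union>j\<in>Z. (\<lambda>x. P i x - P j x) ` (K i \<inter> K j))" using Z(2) by blast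
  then obtain m :: int where m: "m > 0"
      "\<And>q. q \<in> (\<Union>i\<in>Z. \<Union>j\<in>Z. (\<lambda>x. P i x - P j x) ` (K i \<inter> K j)) \<Longrightarrow> of_int m * q \<in> \<int>"
    using common_denominator by blast
  have diff: "of_int m * (P i x - P j x) \<in> \<int>" if "i \<in> Z" "j \<in> Z" "x \<in> K i" "x \<in> K j" for i j x
    using that by (intro m(2)) blast
  have "of_int m * F g \<in> \<int>" if g: "path g" "path_image g \<subseteq> X" "pathfinish g = pathstart g" for g
  proof -
    have gX: "g t \<in> X" if "0 \<le> t" "t \<le> 1" for t using g(2) that by (auto simp: path_image_def)
    then have V_ex: "\<exists>i\<in>Z. g t \<in> V i" if "0 \<le> t" "t \<le> 1" for t using Z(3) that by blast
    \<comment> \<open>Modulo the integers divided by \<open>m\<close>, the value of \<open>F\<close>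
      on the piece of \<open>g\<close> is the difference of primitives at its ends. Allowing every
      chart at each end makes the relation transitive and permits one chart at both ends of a
      loop.\<close>
    define D where "D a b \<longleftrightarrow> (0 \<le> a \<and> b \<le> 1 \<longrightarrow> (\<forall>i\<in>Z. \<forall>j\<in>Z. g a \<in> K i \<and> g b \<in> K j \<longrightarrow>
      of_int m * (F (g \<circ> linepath a b) - (P j (g b) - P i (g a))) \<in> \<int>))" for a b
    have "D 0 1"
    proof (rule Bolzano[where P=D])
      fix a b c assume abc: "D a b" "D b c" "a \<le> b" "b \<le> c"
      show "D a c"
        unfolding D_def
      proof (intro impI ballI)
        fix i j assume ac: "0 \<le> a \<and> c \<le> 1" and ij: "i \<in> Z" "j \<in> Z" "g a \<in> K i \<and> g c \<in> K j"
        obtain k where k: "k \<in> Z" "g b \<in> K k" using V_ex[of b] abc ac VK by (meson order_trans subsetD)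
        have "of_int m * (F (g \<circ> linepath a b) - (P k (g b) - P i (g a))) \<in> \<int>"
          "of_int m * (F (g \<circ> linepath b c) - (P j (g c) - P k (g b))) \<in> \<int>"
          using abc ac ij k by (auto simp: D_def)
        moreover have "F (g \<circ> linepath a c) = F (g \<circ> linepath a b) + F (g \<circ> linepath b c)"
          using abc(3,4) ac by (intro subpaths[OF g(1,2), symmetric]) auto
        ultimately show "of_int m * (F (g \<circ> linepath a c) - (P j (g c) - P i (g a))) \<in> \<int>"
          using Ints_add by (fastforce simp: algebra_simps)
      qed
    next
      fix x :: real assume x: "0 \<le> x" "x \<le> 1"
      then obtain i where i: "i \<in> Z" "g x \<in> V i" using V_ex by blast
      have "openin (top_of_set {0..1}) ({0..1} \<inter> g -` V i)"
        using g(1,2) opV[OF i(1)] unfolding path_def path_image_def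
        by (intro continuous_openin_preimage) auto
      then obtain d where d: "d > 0" "\<And>t. t \<in> {0..1} \<Longrightarrow> dist t x < d \<Longrightarrow> g t \<in> V i"
        using i(2) x unfolding openin_euclidean_subtopology_iff
        by (metis IntE IntI atLeastAtMost_iff vimageE vimageI)
      have "D a b" if ab: "a \<le> x" "x \<le> b" "b - a < d" for a b
        unfolding D_def
      proof (intro impI ballI)
        fix k l assume ab01: "0 \<le> a \<and> b \<le> 1" and kl: "k \<in> Z" "l \<in> Z" "g a \<in> K k \<and> g b \<in> K l"
        have seg: "linepath a b t \<in> {a..b}" if "t \<in> {0..1}" for t
          using linepath_in_path[OF that, of a b] ab by (simp add: closed_segment_eq_real_ivl)
        have gV: "g t \<in> V i" if "t \<in> {a..b}" for t
          using that ab ab01 by (intro d(2)) (auto simp: dist_real_def)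
        have "path (g \<circ> linepath a b)"
          unfolding path_def
        proof (rule continuous_on_compose)
          have "linepath a b ` {0..1} \<subseteq> {0..1}" using seg ab01 by fastforce
          then show "continuous_on (linepath a b ` {0..1}) g"
            using g(1) continuous_on_subset unfolding path_def by blast
        qed (intro continuous_intros)
        moreover have "path_image (g \<circ> linepath a b) \<subseteq> W i"
          using gV seg VK[OF i(1)] KW[OF i(1)] unfolding path_image_def by fastforce
        ultimately have "F (g \<circ> linepath a b) = P i (g b) - P i (g a)"
          using prim[OF i(1)] by (simp add: linepath_def)
        moreover have "g a \<in> K i" "g b \<in> K i" using gV[of a] gV[of b] VK[OF i(1)] ab by auto
        then have "of_int m * (P i (g b) - P l (g b)) \<in> \<int>" "of_int m * (P k (g a) - P i (g a)) \<in> \<int>"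
          using diff kl i(1) by blast+
        from Ints_add[OF this]
        have "of_int m * (P i (g b) - P i (g a) - (P l (g b) - P k (g a))) \<in> \<int>"
          by (simp add: algebra_simps)
        ultimately show "of_int m * (F (g \<circ> linepath a b) - (P l (g b) - P k (g a))) \<in> \<int>" by simp
      qed
      then show "\<exists>d>0. \<forall>a b. a \<le> x \<and> x \<le> b \<and> b - a < d \<longrightarrow> D a b" using d(1) by blast
    qed simp
    \<comment> \<open>With the same chart at both ends of a closed path, the primitive contributes
      nothing.\<close>
    moreover obtain i where "i \<in> Z" "g 0 \<in> K i" using V_ex[of 0] VK by (meson order_refl zero_le_one subsetD)
    moreover have "g 1 = g 0" using g(3) by (simp add: pathfinish_def pathstart_def)
    ultimately have "of_int m * F (g \<circ> linepath 0 1) \<in> \<int>" unfolding D_def by fastforce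
    moreover have "F (g \<circ> linepath 0 1) = F g" by (rule cong) simp
    ultimately show ?thesis by simp
  qed
  then show ?thesis using that m(1) by blast
qed

section \<open>Rational homology\<close>

definition rat_scale :: "rat \<Rightarrow> ('k \<Rightarrow>\<^sub>0 rat) \<Rightarrow> 'k \<Rightarrow>\<^sub>0 rat" where
  "rat_scale q c = Poly_Mapping.map ((*) q) c"

lemma lookup_rat_scale [simp]: "Poly_Mapping.lookup (rat_scale q c) k = q * Poly_Mapping.lookup c k"
  unfolding rat_scale_def by (simp add: Poly_Mapping.map.rep_eq when_def)

interpretation rat_vs: vector_space rat_scale
  by unfold_locales (auto intro!: poly_mapping_eqI simp: lookup_add algebra_simps)

interpretation rat_vs_pair: vector_space_pair rat_scale "(*) :: rat \<Rightarrow> rat \<Rightarrow> rat"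
  by unfold_locales (auto simp: algebra_simps)

lemma single_rat_scale: "Poly_Mapping.single k q = rat_scale q (Poly_Mapping.single k 1)"
  by (rule poly_mapping_eqI) (simp add: lookup_single when_def)

text \<open>A maximal independent subset of \<open>W\<close> stays independent when \<open>z\<close>
  is added. A functional can then be prescribed as 1 at \<open>z\<close> and 0 on that subset; basis
  extension makes this work in spaces of chains of any dimension.\<close>

lemma separating_functional:
  assumes "z \<notin> rat_vs.span W"
  obtains \<psi> :: "('k \<Rightarrow>\<^sub>0 rat) \<Rightarrow> rat" where "\<And>c d. \<psi> (c + d) = \<psi> c + \<psi> d"
    "\<And>q c. \<psi> (rat_scale q c) = q * \<psi> c" "\<And>w. w \<in> W \<Longrightarrow> \<psi> w = 0" "\<psi> z = 1"
proof -
  obtain B where B: "B \<subseteq> W" "rat_vs.independent B" "W \<subseteq> rat_vs.span B"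
    using rat_vs.maximal_independent_subset[of W] by blast
  have z: "z \<notin> rat_vs.span B" using assms B(1) rat_vs.span_mono by blast
  then have "rat_vs.independent (insert z B)" using B(2) by (rule rat_vs.independent_insertI)
  then obtain \<psi> where \<psi>: "Vector_Spaces.linear rat_scale ((*)) \<psi>"
      "\<forall>x\<in>insert z B. \<psi> x = (if x = z then 1 else 0)"
    using rat_vs_pair.linear_independent_extend[of "insert z B" "\<lambda>x. if x = z then 1 else 0"] by blast
  interpret linear: Vector_Spaces.linear rat_scale "(*)" \<psi> by fact
  have "\<psi> b = 0" if "b \<in> B" for b using \<psi>(2) that z rat_vs.span_base by auto
  then have "\<psi> w = 0" if "w \<in> rat_vs.span B" for w
    using rat_vs_pair.linear_eq_0_on_span[OF \<psi>(1)] that by blast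
  then show ?thesis
    using that[of \<psi>] \<psi>(2) B(3) linear.add linear.scale by auto
qed

definition linear_extension :: "('k \<Rightarrow> rat) \<Rightarrow> ('k \<Rightarrow>\<^sub>0 rat) \<Rightarrow> rat" where
  "linear_extension f c = (\<Sum>k\<in>Poly_Mapping.keys c. Poly_Mapping.lookup c k * f k)"

lemma linear_extension_superset:
  "finite A \<Longrightarrow> Poly_Mapping.keys c \<subseteq> A \<Longrightarrow>
    linear_extension f c = (\<Sum>k\<in>A. Poly_Mapping.lookup c k * f k)"
  unfolding linear_extension_def by (rule sum.mono_neutral_left) (auto simp: in_keys_iff)

lemma linear_extension_add: "linear_extension f (c + d) = linear_extension f c + linear_extension f d"
proof -
  let ?A = "Poly_Mapping.keys c \<union> Poly_Mapping.keys d"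
  have "Poly_Mapping.keys (c + d) \<subseteq> ?A" by (rule Poly_Mapping.keys_add)
  then show ?thesis
    by (simp add: linear_extension_superset[of ?A] lookup_add algebra_simps sum.distrib)
qed

lemma linear_extension_zero [simp]: "linear_extension f 0 = 0"
  by (simp add: linear_extension_def)

lemma linear_extension_single [simp]: "linear_extension f (Poly_Mapping.single k q) = q * f k"
  by (simp add: linear_extension_def)

lemma linear_extension_sum: "linear_extension f (sum g A) = (\<Sum>a\<in>A. linear_extension f (g a))"
  by (induction A rule: infinite_finite_induct) (auto simp: linear_extension_add)

section \<open>Rational chains and their boundaries\<close>

definition simplex_boundary :: "nat \<Rightarrow> ((nat \<Rightarrow> real) \<Rightarrow> 'a) \<Rightarrow> 'a rat_chain" where
  "simplex_boundary n \<sigma> = (\<Sum>k\<le>n. Poly_Mapping.single (singular_face n k \<sigma>) ((-1) ^ k))"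

text \<open>Summing over any finite superset of the support gives several chains a common index set,
  so linearity can be checked term by term.\<close>

lemma rat_boundary_superset:
  assumes "n > 0" "finite A" "Poly_Mapping.keys c \<subseteq> A"
  shows "rat_boundary n c = (\<Sum>\<sigma>\<in>A. rat_scale (Poly_Mapping.lookup c \<sigma>) (simplex_boundary n \<sigma>))"
proof -
  have *: "(\<Sum>k\<le>n. Poly_Mapping.single (singular_face n k \<sigma>) ((-1) ^ k * Poly_Mapping.lookup c \<sigma>))
      = rat_scale (Poly_Mapping.lookup c \<sigma>) (simplex_boundary n \<sigma>)" for \<sigma>
    unfolding simplex_boundary_def rat_vs.scale_sum_right
    by (intro sum.cong refl poly_mapping_eqI) (simp add: lookup_single when_def)
  show ?thesis
    using assms(1) unfolding rat_boundary_def *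
    by (auto intro!: sum.mono_neutral_left assms simp: in_keys_iff)
qed

lemma rat_boundary_zero [simp]: "rat_boundary n 0 = 0"
  by (simp add: rat_boundary_def)

lemma rat_boundary_single: "n > 0 \<Longrightarrow> rat_boundary n (Poly_Mapping.single \<sigma> q) = rat_scale q (simplex_boundary n \<sigma>)"
  by (subst rat_boundary_superset[of n "{\<sigma>}"]) auto

lemma rat_boundary_add: "rat_boundary n (c + d) = rat_boundary n c + rat_boundary n d"
proof (cases "n = 0")
  case False
  let ?A = "Poly_Mapping.keys c \<union> Poly_Mapping.keys d"
  have "Poly_Mapping.keys (c + d) \<subseteq> ?A" by (rule Poly_Mapping.keys_add)
  with False show ?thesis
    by (simp add: rat_boundary_superset[of n ?A] lookup_add rat_vs.scale_left_distrib sum.distrib)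
qed (simp add: rat_boundary_def)

lemma keys_rat_scale: "Poly_Mapping.keys (rat_scale q c) \<subseteq> Poly_Mapping.keys c"
  by (auto simp: in_keys_iff)

lemma rat_boundary_scale: "rat_boundary n (rat_scale q c) = rat_scale q (rat_boundary n c)"
proof (cases "n = 0")
  case False
  with keys_rat_scale[of q c] show ?thesis
    by (simp add: rat_boundary_superset[of n "Poly_Mapping.keys c"] rat_vs.scale_sum_right)
qed (simp add: rat_boundary_def)

lemma subspace_rat_chains: "rat_vs.subspace (rat_chains n X)"
  unfolding rat_vs.subspace_def rat_chains_def
  using Poly_Mapping.keys_add keys_rat_scale by fastforce

lemma subspace_rat_cycles: "rat_vs.subspace (rat_cycles n X)"
  using subspace_rat_chains[of n X]
  by (auto simp: rat_vs.subspace_def rat_cycles_def rat_boundary_add rat_boundary_scale)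

lemma subspace_rat_boundaries: "rat_vs.subspace (rat_boundaries n X)"
  unfolding rat_vs.subspace_def rat_boundaries_def
proof (intro conjI ballI allI)
  note chains = subspace_rat_chains[of "Suc n" X, unfolded rat_vs.subspace_def]
  show "0 \<in> rat_boundary (Suc n) ` rat_chains (Suc n) X"
    using chains by (intro image_eqI[where x=0]) auto
  fix x assume "x \<in> rat_boundary (Suc n) ` rat_chains (Suc n) X"
  then obtain c where c: "c \<in> rat_chains (Suc n) X" "x = rat_boundary (Suc n) c" by auto
  show "rat_scale q x \<in> rat_boundary (Suc n) ` rat_chains (Suc n) X" for q
    using chains c by (intro image_eqI[where x="rat_scale q c"]) (auto simp: rat_boundary_scale)
  fix y assume "y \<in> rat_boundary (Suc n) ` rat_chains (Suc n) X"
  then obtain d where d: "d \<in> rat_chains (Suc n) X" "y = rat_boundary (Suc n) d" by auto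
  show "x + y \<in> rat_boundary (Suc n) ` rat_chains (Suc n) X"
    using chains c d by (intro image_eqI[where x="c + d"]) (auto simp: rat_boundary_add)
qed

section \<open>The homology quotient and functionals on it\<close>

lemma rat_homology_class_self: "c \<in> rat_homology_class n X c"
  unfolding rat_homology_class_def
  using rat_vs.subspace_0[OF subspace_rat_boundaries, of n X] by (metis (mono_tags, lifting) add.right_neutral mem_Collect_eq)

lemma rat_homology_class_eqI:
  assumes "a - c \<in> rat_boundaries n X"
  shows "rat_homology_class n X a = rat_homology_class n X c"
proof -
  have B: "rat_vs.subspace (rat_boundaries n X)" by (rule subspace_rat_boundaries)
  have sub: "rat_homology_class n X a \<subseteq> rat_homology_class n X c"
    if ac: "a - c \<in> rat_boundaries n X" for a c
  proof
    fix x assume "x \<in> rat_homology_class n X a"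
    then obtain b where b: "b \<in> rat_boundaries n X" "x = a + b"
      by (auto simp: rat_homology_class_def)
    then have "x = c + ((a - c) + b)" by simp
    then show "x \<in> rat_homology_class n X c"
      unfolding rat_homology_class_def using rat_vs.subspace_add[OF B ac b(1)] by blast
  qed
  have "c - a \<in> rat_boundaries n X"
    using rat_vs.subspace_neg[OF B assms] by simp
  then show ?thesis using sub[OF assms] sub[of c a] by blast
qed

text \<open>The sum of classes is encoded as a union over all representatives. Every member of that
  union is the same class, so the union is that class.\<close>

lemma rat_homology_add:
  "rat_homology_class n X c \<oplus>\<^bsub>rat_homology n X\<^esub> rat_homology_class n X d = rat_homology_class n X (c + d)"
proof -
  have "rat_homology_class n X (a + b) = rat_homology_class n X (c + d)"
    if ab: "a \<in> rat_homology_class n X c" "b \<in> rat_homology_class n X d" for a b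
  proof (rule rat_homology_class_eqI)
    obtain u v where "u \<in> rat_boundaries n X" "v \<in> rat_boundaries n X" "a = c + u" "b = d + v"
      using ab by (auto simp: rat_homology_class_def)
    then show "a + b - (c + d) \<in> rat_boundaries n X"
      using rat_vs.subspace_add[OF subspace_rat_boundaries, of u n X v] by simp
  qed
  then have "(\<Union>a\<in>rat_homology_class n X c. \<Union>b\<in>rat_homology_class n X d. rat_homology_class n X (a + b))
      = rat_homology_class n X (c + d)"
    using rat_homology_class_self[of c n X] rat_homology_class_self[of d n X] by blast
  then show ?thesis by (simp add: rat_homology_def)
qed

lemma rat_homology_smult:
  "q \<odot>\<^bsub>rat_homology n X\<^esub> rat_homology_class n X c = rat_homology_class n X (rat_scale q c)"
proof -
  have "rat_homology_class n X (rat_scale q a) = rat_homology_class n X (rat_scale q c)"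
    if a: "a \<in> rat_homology_class n X c" for a
  proof (rule rat_homology_class_eqI)
    obtain u where "u \<in> rat_boundaries n X" "a = c + u"
      using a by (auto simp: rat_homology_class_def)
    then show "rat_scale q a - rat_scale q c \<in> rat_boundaries n X"
      using rat_vs.subspace_scale[OF subspace_rat_boundaries, of u n X q]
      by (simp add: rat_vs.scale_right_distrib)
  qed
  then have "(\<Union>a\<in>rat_homology_class n X c. rat_homology_class n X (rat_scale q a))
      = rat_homology_class n X (rat_scale q c)"
    using rat_homology_class_self[of c n X] by blast
  then show ?thesis by (simp add: rat_homology_def rat_scale_def)
qed

lemma rat_homology_zero: "\<zero>\<^bsub>rat_homology n X\<^esub> = rat_homology_class n X 0"
  by (simp add: rat_homology_def rat_homology_class_def)

lemma carrier_rat_homology: "carrier (rat_homology n X) = rat_homology_class n X ` rat_cycles n X"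
  by (simp add: rat_homology_def)

lemma module_rat_homology: "Module.module class_ring (rat_homology n X)"
proof (rule module_criteria)
  note Z = subspace_rat_cycles[of n X]
  show "cring (class_ring :: rat ring)" by (rule class_cring.is_cring)
  show "\<forall>v\<in>carrier (rat_homology n X). \<exists>w\<in>carrier (rat_homology n X). v \<oplus>\<^bsub>rat_homology n X\<^esub> w = \<zero>\<^bsub>rat_homology n X\<^esub>"
  proof
    fix v assume "v \<in> carrier (rat_homology n X)"
    then obtain c where c: "c \<in> rat_cycles n X" "v = rat_homology_class n X c"
      by (auto simp: carrier_rat_homology)
    show "\<exists>w\<in>carrier (rat_homology n X). v \<oplus>\<^bsub>rat_homology n X\<^esub> w = \<zero>\<^bsub>rat_homology n X\<^esub>"
      using c rat_vs.subspace_neg[OF Z c(1)]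
      by (intro bexI[of _ "rat_homology_class n X (- c)"])
        (auto simp: carrier_rat_homology rat_homology_add rat_homology_zero)
  qed
qed (auto simp: carrier_rat_homology rat_homology_add rat_homology_smult rat_homology_zero
      rat_vs.scale_left_distrib rat_vs.scale_right_distrib ac_simps
    intro: imageI rat_vs.subspace_0[OF subspace_rat_cycles]
      rat_vs.subspace_add[OF subspace_rat_cycles] rat_vs.subspace_scale[OF subspace_rat_cycles])

text \<open>Chains whose class lies in the span form a subspace containing the boundaries and
  \<open>G\<close>. A cycle whose class is outside the span is therefore outside the chain-level
  span of boundaries and \<open>G\<close>, and is separated from it there. The functional obtained
  is defined on all chains, so single paths can be evaluated.\<close>

lemma homology_functional:
  assumes G: "G \<subseteq> rat_cycles n X"
    and ne: "LinearCombinations.module.span class_ring (rat_homology n X) (rat_homology_class n X ` G)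
      \<noteq> carrier (rat_homology n X)"
  obtains \<psi> z where "\<And>c d. \<psi> (c + d) = \<psi> c + \<psi> d" "\<And>q c. \<psi> (rat_scale q c) = q * \<psi> c"
    "\<And>b. b \<in> rat_boundaries n X \<Longrightarrow> \<psi> b = 0" "\<And>c. c \<in> G \<Longrightarrow> \<psi> c = 0"
    "z \<in> rat_cycles n X" "\<psi> z = (1 :: rat)"
proof -
  let ?H = "rat_homology n X"
  interpret H: module class_ring ?H by (rule module_rat_homology)
  let ?G = "rat_homology_class n X ` G"
  have GH: "?G \<subseteq> carrier ?H" using G by (auto simp: carrier_rat_homology)
  have sub: "submodule class_ring (H.span ?G) ?H" using GH by (rule H.span_is_submodule)
  have "H.span ?G \<subseteq> carrier ?H" using sub by (rule submodule.subset)
  then obtain z where z: "z \<in> rat_cycles n X" "rat_homology_class n X z \<notin> H.span ?G"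
    using ne by (auto simp: carrier_rat_homology)
  have "rat_homology_class n X c \<in> H.span ?G" if "c \<in> rat_vs.span (rat_boundaries n X \<union> G)" for c
    using that
  proof (induction rule: rat_vs.span_induct)
    show "rat_vs.subspace {c. rat_homology_class n X c \<in> H.span ?G}"
      unfolding rat_vs.subspace_def
      using submodule.zero_closed[OF sub] submodule.m_closed[OF sub] submodule.smult_closed[OF sub]
      by (auto simp: rat_homology_zero simp flip: rat_homology_add rat_homology_smult)
    fix c assume c: "c \<in> rat_boundaries n X \<union> G"
    show "rat_homology_class n X c \<in> H.span ?G"
    proof (cases "c \<in> rat_boundaries n X")
      case True
      then have "rat_homology_class n X c = rat_homology_class n X 0"
        by (intro rat_homology_class_eqI) simp
      then show ?thesis using submodule.zero_closed[OF sub] by (simp add: rat_homology_zero)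
    next
      case False
      then show ?thesis using c H.in_own_span[OF GH] by blast
    qed
  qed
  then have "z \<notin> rat_vs.span (rat_boundaries n X \<union> G)" using z(2) by blast
  then obtain \<psi> :: "_ \<Rightarrow> rat" where "\<And>c d. \<psi> (c + d) = \<psi> c + \<psi> d"
    "\<And>q c. \<psi> (rat_scale q c) = q * \<psi> c" "\<And>w. w \<in> rat_boundaries n X \<union> G \<Longrightarrow> \<psi> w = 0" "\<psi> z = 1"
    using separating_functional by blast
  then show ?thesis using that[of \<psi> z] z(1) by blast
qed

section \<open>Singular 1-simplices as paths\<close>

lemma singular_simplex_top_of_set:
  "singular_simplex n (top_of_set X) \<sigma> \<longleftrightarrow>
    continuous_on (standard_simplex n) \<sigma> \<and> \<sigma> ` standard_simplex n \<subseteq> X \<and> \<sigma> \<in> extensional (standard_simplex n)"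
  by (auto simp: singular_simplex_def euclidean_product_topology)

lemma standard_simplex_1:
  "t \<in> standard_simplex 1 \<longleftrightarrow> 0 \<le> t 1 \<and> t 1 \<le> 1 \<and> t = (\<lambda>i. if i = 0 then 1 - t 1 else if i = 1 then t 1 else 0)"
proof
  assume t: "t \<in> standard_simplex 1"
  then have *: "t 0 + t 1 = 1" "0 \<le> t 1" "t 1 \<le> 1" "\<And>i. i > 1 \<Longrightarrow> t i = 0"
    by (auto simp: standard_simplex_def)
  have "t = (\<lambda>i. if i = 0 then 1 - t 1 else if i = 1 then t 1 else 0)"
  proof
    fix i show "t i = (if i = 0 then 1 - t 1 else if i = 1 then t 1 else 0)"
      using * less_linear[of i 1] by auto
  qed
  with * show "0 \<le> t 1 \<and> t 1 \<le> 1 \<and> t = (\<lambda>i. if i = 0 then 1 - t 1 else if i = 1 then t 1 else 0)"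
    by blast
next
  assume *: "0 \<le> t 1 \<and> t 1 \<le> 1 \<and> t = (\<lambda>i. if i = 0 then 1 - t 1 else if i = 1 then t 1 else 0)"
  have "(\<lambda>i. if i = 0 then 1 - s else if i = 1 then s else 0) \<in> standard_simplex 1"
    if "0 \<le> s" "s \<le> 1" for s :: real
    using that by (auto simp: standard_simplex_def)
  with * show "t \<in> standard_simplex 1"
    by (subst conjunct2[OF conjunct2[OF *]]) blast
qed

text \<open>Inverse to \<open>path_simplex\<close>: the parameter is the barycentric coordinate of
  vertex 1.\<close>

definition simplex_path :: "((nat \<Rightarrow> real) \<Rightarrow> 'a) \<Rightarrow> real \<Rightarrow> 'a" where
  "simplex_path \<sigma> s = \<sigma> (\<lambda>i. if i = 0 then 1 - s else if i = 1 then s else 0)"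

lemma path_simplex_simplex_path:
  assumes "\<sigma> \<in> extensional (standard_simplex 1)"
  shows "path_simplex (simplex_path \<sigma>) = \<sigma>"
proof
  fix t show "path_simplex (simplex_path \<sigma>) t = \<sigma> t"
  proof (cases "t \<in> standard_simplex 1")
    case True
    then have "t = (\<lambda>i. if i = 0 then 1 - t 1 else if i = 1 then t 1 else 0)"
      by (simp only: standard_simplex_1)
    from arg_cong[OF this, of \<sigma>] have "simplex_path \<sigma> (t 1) = \<sigma> t"
      by (simp only: simplex_path_def)
    then show ?thesis using True by (simp add: path_simplex_def)
  next
    case False
    then show ?thesis using assms by (simp add: path_simplex_def extensional_def)
  qed
qed

lemma path_simplex_cong:
  assumes "\<And>t. t \<in> {0..1} \<Longrightarrow> g t = h t"
  shows "path_simplex g = path_simplex h"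
  unfolding path_simplex_def
  by (rule restrict_ext) (use assms in \<open>auto simp: standard_simplex_def\<close>)

lemma simplex_path_in:
  assumes "singular_simplex 1 (top_of_set X) \<sigma>"
  shows "path (simplex_path \<sigma>)" "path_image (simplex_path \<sigma>) \<subseteq> X"
proof -
  let ?e = "\<lambda>s::real. \<lambda>i::nat. if i = 0 then 1 - s else if i = 1 then s else 0"
  have e: "?e s \<in> standard_simplex 1" if "s \<in> {0..1}" for s
    using that by (auto simp: standard_simplex_def)
  have \<sigma>: "continuous_on (standard_simplex 1) \<sigma>" "\<sigma> ` standard_simplex 1 \<subseteq> X"
    using assms by (auto simp: singular_simplex_top_of_set)
  have cont: "continuous_on {0..1} ?e"
  proof (rule continuous_on_coordinatewise_then_product)
    fix i show "continuous_on {0..1} (\<lambda>s. ?e s i)"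
      by (cases "i = 0"; cases "i = 1") (auto intro!: continuous_intros)
  qed
  show "path (simplex_path \<sigma>)"
    unfolding path_def simplex_path_def
    by (rule continuous_on_compose2[OF \<sigma>(1) cont]) (intro image_subsetI e)
  show "path_image (simplex_path \<sigma>) \<subseteq> X"
    unfolding path_image_def simplex_path_def using e \<sigma>(2) by blast
qed

lemma singular_simplex_path_simplex:
  assumes "path g" "path_image g \<subseteq> X"
  shows "singular_simplex 1 (top_of_set X) (path_simplex g)"
  unfolding singular_simplex_top_of_set
proof (intro conjI)
  have "continuous_on (standard_simplex 1) (\<lambda>t. g (t 1))"
    by (rule continuous_on_compose2[OF assms(1)[unfolded path_def]])
      (auto simp: standard_simplex_def intro: continuous_on_subset[OF continuous_on_product_coordinates])
  then show "continuous_on (standard_simplex 1) (path_simplex g)"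
    by (rule continuous_on_eq) (simp add: path_simplex_def)
  show "path_simplex g ` standard_simplex 1 \<subseteq> X"
    using assms(2) by (auto simp: path_simplex_def path_image_def standard_simplex_def)
qed (simp add: path_simplex_def)

lemma simplex_boundary_1:
  "simplex_boundary 1 \<sigma> = Poly_Mapping.single (singular_face 1 0 \<sigma>) 1 - Poly_Mapping.single (singular_face 1 1 \<sigma>) 1"
  by (simp add: simplex_boundary_def single_uminus)

text \<open>The argument is the only point of the standard 0-simplex. Face 0 omits vertex 0 and so
  gives the end of the path; face 1 gives its start.\<close>

lemma singular_face_1:
  "singular_face 1 0 \<sigma> (\<lambda>j. if j = 0 then 1 else 0) = simplex_path \<sigma> 1"
  "singular_face 1 1 \<sigma> (\<lambda>j. if j = 0 then 1 else 0) = simplex_path \<sigma> 0"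
proof -
  have 0: "(\<lambda>j. if j = 0 then 1 else 0) \<in> standard_simplex (Suc 0 - Suc 0)"
    by (simp add: standard_simplex_def)
  have "simplical_face 0 (\<lambda>j. if j = 0 then 1 else 0) = (\<lambda>i. if i = 0 then 1 - 1 else if i = 1 then 1 else (0::real))"
    "simplical_face 1 (\<lambda>j. if j = 0 then 1 else 0) = (\<lambda>i. if i = 0 then 1 - 0 else if i = 1 then 0 else (0::real))"
    by (auto simp: simplical_face_def fun_eq_iff)
  with 0 show "singular_face 1 0 \<sigma> (\<lambda>j. if j = 0 then 1 else 0) = simplex_path \<sigma> 1"
    "singular_face 1 1 \<sigma> (\<lambda>j. if j = 0 then 1 else 0) = simplex_path \<sigma> 0"
    by (simp_all add: singular_face_def simplex_path_def)
qed

text \<open>The two faces agree at the only point of the 0-simplex and both have the default value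
  elsewhere, so they are equal as functions and cancel.\<close>

lemma loop_rat_cycle:
  assumes "loop_at X x g"
  shows "Poly_Mapping.single (path_simplex g) 1 \<in> rat_cycles 1 (top_of_set X)"
proof -
  have s: "singular_simplex 1 (top_of_set X) (path_simplex g)"
    using assms by (intro singular_simplex_path_simplex) (auto simp: loop_at_def)
  have ends: "simplex_path (path_simplex g) 0 = g 0" "simplex_path (path_simplex g) 1 = g 1"
  proof -
    have "(\<lambda>i. if i = 0 then 1 - s else if i = 1 then s else 0) \<in> standard_simplex 1"
      if "s \<in> {0, 1}" for s :: real
      using that by (auto simp: standard_simplex_def)
    then show "simplex_path (path_simplex g) 0 = g 0" "simplex_path (path_simplex g) 1 = g 1"
      by (simp_all add: simplex_path_def path_simplex_def)
  qed
  have "singular_face 1 0 (path_simplex g) = singular_face 1 1 (path_simplex g)"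
  proof
    fix t :: "nat \<Rightarrow> real"
    show "singular_face 1 0 (path_simplex g) t = singular_face 1 1 (path_simplex g) t"
    proof (cases "t = (\<lambda>j. if j = 0 then 1 else 0)")
      case True
      then show ?thesis using assms singular_face_1[of "path_simplex g"] ends
        by (auto simp: loop_at_def pathstart_def pathfinish_def)
    next
      case False
      then show ?thesis by (simp add: singular_face_def standard_simplex_0)
    qed
  qed
  then have "rat_boundary 1 (Poly_Mapping.single (path_simplex g) 1) = 0"
    by (simp add: rat_boundary_single simplex_boundary_1 del: One_nat_def)
  then show ?thesis using s by (simp add: rat_cycles_def rat_chains_def)
qed

text \<open>Barycentric coordinates turn the triangle a, b, c into a singular 2-simplex, by
  convexity of the square. Its boundary is bc - ac + ab, and \<psi> kills it.\<close>

lemma path_cocycle_functional: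
  fixes X :: "'b::topological_space set"
  assumes add: "\<And>c d. \<psi> (c + d) = \<psi> c + \<psi> d" and scale: "\<And>q c. \<psi> (rat_scale q c) = q * \<psi> c"
    and bd: "\<And>b. b \<in> rat_boundaries 1 (top_of_set X) \<Longrightarrow> \<psi> b = 0"
  shows "path_cocycle X (\<lambda>g. \<psi> (Poly_Mapping.single (path_simplex g) 1))"
proof
  fix g h :: "real \<Rightarrow> 'b" assume "\<And>t. t \<in> {0..1} \<Longrightarrow> g t = h t"
  then have "path_simplex g = path_simplex h" by (rule path_simplex_cong)
  then show "\<psi> (Poly_Mapping.single (path_simplex g) 1) = \<psi> (Poly_Mapping.single (path_simplex h) 1)" by simp
next
  fix h :: "real \<times> real \<Rightarrow> 'b" and a b c :: "real \<times> real"
  let ?Q = "{0..1} \<times> {0..1} :: (real \<times> real) set"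
  let ?s = "\<lambda>\<sigma> q. Poly_Mapping.single \<sigma> q :: 'b rat_chain"
  assume h: "continuous_on ?Q h" "h ` ?Q \<subseteq> X" and abc: "a \<in> ?Q" "b \<in> ?Q" "c \<in> ?Q"
  let ?l = "\<lambda>t :: nat \<Rightarrow> real. t 0 *\<^sub>R a + t 1 *\<^sub>R b + t 2 *\<^sub>R c"
  define \<tau> where "\<tau> = restrict (h \<circ> ?l) (standard_simplex 2)"
  have lQ: "?l t \<in> ?Q" if t: "t \<in> standard_simplex 2" for t
  proof -
    have "{..2::nat} = {0, 1, 2}" by auto
    then have "t 0 + t 1 + t 2 = 1" "0 \<le> t 0" "0 \<le> t 1" "0 \<le> t 2"
      using t by (auto simp: standard_simplex_def)
    moreover have "r * u + s * v + q * w \<in> {0..1}"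
      if "r + s + q = 1" "0 \<le> r" "0 \<le> s" "0 \<le> q" "u \<in> {0..1}" "v \<in> {0..1}" "w \<in> {0..1}"
      for r s q u v w :: real
      using mult_left_le[of u r] mult_left_le[of v s] mult_left_le[of w q] that by auto
    ultimately show ?thesis
      using abc by (cases a; cases b; cases c) simp
  qed
  have \<tau>: "singular_simplex 2 (top_of_set X) \<tau>"
    unfolding singular_simplex_top_of_set
  proof (intro conjI)
    have "continuous_on (standard_simplex 2) ?l"
      by (intro continuous_intros continuous_on_subset[OF continuous_on_product_coordinates]) auto
    then have "continuous_on (standard_simplex 2) (h \<circ> ?l)"
      by (rule continuous_on_compose) (rule continuous_on_subset[OF h(1)], intro image_subsetI lQ)
    then show "continuous_on (standard_simplex 2) \<tau>"
      by (rule continuous_on_eq) (simp add: \<tau>_def)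
    show "\<tau> ` standard_simplex 2 \<subseteq> X"
      using lQ h(2) by (auto simp: \<tau>_def)
  qed (simp add: \<tau>_def)
  \<comment> \<open>Face \<open>k\<close> omits vertex \<open>k\<close>; the hypothesis on
    \<open>u\<close> and \<open>v\<close> names the two remaining vertices in order.\<close>
  have face: "singular_face 2 k \<tau> = path_simplex (h \<circ> linepath u v)"
    if k: "k \<le> 2" and uv: "\<And>t :: nat \<Rightarrow> real. t 0 + t 1 = 1 \<Longrightarrow> ?l (simplical_face k t) = t 0 *\<^sub>R u + t 1 *\<^sub>R v" for k u v
  proof
    fix t show "singular_face 2 k \<tau> t = path_simplex (h \<circ> linepath u v) t"
    proof (cases "t \<in> standard_simplex 1")
      case True
      then have t: "t 0 + t 1 = 1" by (auto simp: standard_simplex_def)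
      have "simplical_face k t \<in> standard_simplex 2"
        using True k by (intro simplical_face_in_standard_simplex) auto
      then have "singular_face 2 k \<tau> t = h (?l (simplical_face k t))"
        using True by (simp add: singular_face_def \<tau>_def)
      also have "\<dots> = h (t 0 *\<^sub>R u + t 1 *\<^sub>R v)" by (simp only: uv[OF t])
      finally have "singular_face 2 k \<tau> t = h (t 0 *\<^sub>R u + t 1 *\<^sub>R v)" .
      moreover have "t 0 = 1 - t 1" using t by simp
      ultimately show ?thesis using True by (simp add: path_simplex_def linepath_def)
    next
      case False
      then show ?thesis by (simp add: singular_face_def path_simplex_def)
    qed
  qed
  have faces: "singular_face 2 0 \<tau> = path_simplex (h \<circ> linepath b c)"
    "singular_face 2 1 \<tau> = path_simplex (h \<circ> linepath a c)"
    "singular_face 2 2 \<tau> = path_simplex (h \<circ> linepath a b)"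
    by (rule face; simp add: simplical_face_def)+
  have "rat_boundary 2 (?s \<tau> 1) \<in> rat_boundaries 1 (top_of_set X)"
    using \<tau> unfolding rat_boundaries_def by (simp add: rat_chains_def numeral_2_eq_2)
  then have "\<psi> (rat_boundary 2 (?s \<tau> 1)) = 0" by (rule bd)
  moreover have "{..2::nat} = {0, 1, 2}" by auto
  then have "rat_boundary 2 (?s \<tau> 1) = ?s (singular_face 2 0 \<tau>) 1 +
      (?s (singular_face 2 2 \<tau>) 1 - ?s (singular_face 2 1 \<tau>) 1)"
    by (simp add: rat_boundary_single simplex_boundary_def single_uminus)
  moreover have diff: "\<psi> (c - d) = \<psi> c - \<psi> d" for c d using add[of "c - d" d] by simp
  ultimately show "\<psi> (?s (path_simplex (h \<circ> linepath a b)) 1) + \<psi> (?s (path_simplex (h \<circ> linepath b c)) 1)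
      = \<psi> (?s (path_simplex (h \<circ> linepath a c)) 1)"
    unfolding faces by (simp add: add diff)
qed

text \<open>A cycle is homologous to a combination of loops: close up every simplex by paths from the
  base point; since the boundary vanishes, these paths cancel.\<close>

lemma functional_zero_on_cycles:
  fixes X :: "'b::topological_space set"
  assumes add: "\<And>c d. \<psi> (c + d) = \<psi> c + \<psi> d" and scale: "\<And>q c. \<psi> (rat_scale q c) = q * \<psi> c"
    and bd: "\<And>b. b \<in> rat_boundaries 1 (top_of_set X) \<Longrightarrow> \<psi> b = 0"
    and X: "path_connected X" "x \<in> X"
    and loops: "\<And>g. loop_at X x g \<Longrightarrow> \<psi> (Poly_Mapping.single (path_simplex g) 1) = 0"
    and z: "z \<in> rat_cycles 1 (top_of_set X)"
  shows "\<psi> z = 0"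
proof -
  interpret path_cocycle X "\<lambda>g. \<psi> (Poly_Mapping.single (path_simplex g) 1)"
    using add scale bd by (rule path_cocycle_functional)
  let ?F = "\<lambda>g. \<psi> (Poly_Mapping.single (path_simplex g) 1)"
  let ?e = "\<lambda>j::nat. if j = 0 then 1 else (0::real)"
  have "\<forall>v\<in>X. \<exists>l. path l \<and> path_image l \<subseteq> X \<and> pathstart l = x \<and> pathfinish l = v"
    using X unfolding path_connected_def by blast
  from bchoice[OF this] obtain l where
    l: "\<And>v. v \<in> X \<Longrightarrow> path (l v) \<and> path_image (l v) \<subseteq> X \<and> pathstart (l v) = x \<and> pathfinish (l v) = v"
    by blast
  \<comment> \<open>A global potential. Closing a path up by the chosen paths to its ends gives a
    loop at \<open>x\<close>, where the functional vanishes; so its value on any path is a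
    difference of values of \<open>G\<close>.\<close>
  define G where "G v = ?F (l v)" for v
  have F: "?F g = G (g 1) - G (g 0)" if g: "path g" "path_image g \<subseteq> X" for g
  proof -
    have ends: "g 0 \<in> X" "g 1 \<in> X" using g(2) by (auto simp: path_image_def)
    note l0 = l[OF ends(1)] and l1 = l[OF ends(2)]
    have f: "pathstart g = g 0" "pathfinish g = g 1" by (simp_all add: pathstart_def pathfinish_def)
    have p: "path (g +++ reversepath (l (g 1)))" "path_image (g +++ reversepath (l (g 1))) \<subseteq> X"
      using g l1 f by (auto simp: path_image_join)
    have "loop_at X x (l (g 0) +++ (g +++ reversepath (l (g 1))))"
      using l0 l1 p f by (auto simp: loop_at_def path_image_join)
    then have "0 = ?F (l (g 0) +++ (g +++ reversepath (l (g 1))))" using loops by simp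
    also have "\<dots> = ?F (l (g 0)) + ?F (g +++ reversepath (l (g 1)))"
      using l0 p f by (intro join) auto
    also have "?F (g +++ reversepath (l (g 1))) = ?F g + ?F (reversepath (l (g 1)))"
      using g l1 f by (intro join) auto
    also have "?F (reversepath (l (g 1))) = - ?F (l (g 1))"
      using l1 by (intro reverse) auto
    finally show ?thesis by (simp add: G_def)
  qed
  have sing: "singular_simplex 1 (top_of_set X) \<sigma>" if "\<sigma> \<in> Poly_Mapping.keys z" for \<sigma>
    using z that by (auto simp: rat_cycles_def rat_chains_def)
  have \<psi>0: "\<psi> 0 = 0" using add[of 0 0] by simp
  have \<psi>_sum: "\<psi> (sum f A) = (\<Sum>a\<in>A. \<psi> (f a))" for f and A :: "((nat \<Rightarrow> real) \<Rightarrow> 'b) set"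
    by (induction A rule: infinite_finite_induct) (auto simp: add \<psi>0)
  have \<psi>_single: "\<psi> (Poly_Mapping.single \<sigma> q) = q * (G (simplex_path \<sigma> 1) - G (simplex_path \<sigma> 0))"
    if "\<sigma> \<in> Poly_Mapping.keys z" for \<sigma> q
  proof -
    have "\<psi> (Poly_Mapping.single \<sigma> q) = q * \<psi> (Poly_Mapping.single \<sigma> 1)"
      by (subst single_rat_scale) (rule scale)
    also have "\<psi> (Poly_Mapping.single \<sigma> 1) = ?F (simplex_path \<sigma>)"
      using sing[OF that] by (simp add: path_simplex_simplex_path singular_simplex_top_of_set)
    also have "\<dots> = G (simplex_path \<sigma> 1) - G (simplex_path \<sigma> 0)"
      using simplex_path_in[OF sing[OF that]] by (rule F)
    finally show ?thesis .
  qed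
  have "z = (\<Sum>\<sigma>\<in>Poly_Mapping.keys z. Poly_Mapping.single \<sigma> (Poly_Mapping.lookup z \<sigma>))"
    by (rule poly_mapping_eqI) (simp add: lookup_sum lookup_single when_def in_keys_iff)
  then have "\<psi> z = \<psi> (\<Sum>\<sigma>\<in>Poly_Mapping.keys z. Poly_Mapping.single \<sigma> (Poly_Mapping.lookup z \<sigma>))"
    by (rule arg_cong)
  also have "\<dots> = (\<Sum>\<sigma>\<in>Poly_Mapping.keys z. Poly_Mapping.lookup z \<sigma> * (G (simplex_path \<sigma> 1) - G (simplex_path \<sigma> 0)))"
    unfolding \<psi>_sum by (intro sum.cong refl \<psi>_single)
  \<comment> \<open>The sum of potential differences is the potential, extended linearly to
    0-chains, evaluated on the boundary of \<open>z\<close>. A 0-simplex is read through its value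
    at the one point of its domain.\<close>
  also have "\<dots> = (\<Sum>\<sigma>\<in>Poly_Mapping.keys z. linear_extension (\<lambda>s. G (s ?e))
      (rat_scale (Poly_Mapping.lookup z \<sigma>) (simplex_boundary 1 \<sigma>)))"
  proof (rule sum.cong)
    fix \<sigma> :: "(nat \<Rightarrow> real) \<Rightarrow> 'b"
    have "rat_scale q (simplex_boundary 1 \<sigma>) = Poly_Mapping.single (singular_face 1 0 \<sigma>) q
        + Poly_Mapping.single (singular_face 1 1 \<sigma>) (- q)" for q
      unfolding simplex_boundary_1
      by (rule poly_mapping_eqI) (simp add: lookup_add lookup_minus lookup_single when_def)
    then show "Poly_Mapping.lookup z \<sigma> * (G (simplex_path \<sigma> 1) - G (simplex_path \<sigma> 0))
        = linear_extension (\<lambda>s. G (s ?e)) (rat_scale (Poly_Mapping.lookup z \<sigma>) (simplex_boundary 1 \<sigma>))"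
      by (simp add: linear_extension_add singular_face_1 algebra_simps del: One_nat_def)
  qed simp
  also have "\<dots> = linear_extension (\<lambda>s. G (s ?e)) (rat_boundary 1 z)"
    by (subst rat_boundary_superset[of 1 "Poly_Mapping.keys z" z]) (auto simp: linear_extension_sum)
  also have "\<dots> = 0" using z by (simp add: rat_cycles_def)
  finally show ?thesis .
qed

section \<open>Cover subgroups and the representation\<close>

lemma loop_at_image:
  assumes "continuous_on C p" "p ` C \<subseteq> S" "loop_at C y g"
  shows "loop_at S (p y) (p \<circ> g)"
proof -
  have "path (p \<circ> g)"
    using assms by (intro path_continuous_image) (auto simp: loop_at_def intro: continuous_on_subset)
  then show ?thesis
    using assms by (auto simp: loop_at_def path_image_compose pathstart_compose pathfinish_compose)
qed

lemma pi1_map_class: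
  assumes p: "continuous_on C p" "p ` C \<subseteq> S" and g: "loop_at C y g"
  shows "pi1_map p S (path_class C g) = path_class S (p \<circ> g)"
proof -
  have "path_class S (p \<circ> h) = path_class S (p \<circ> g)" if "h \<in> path_class C g" for h
  proof -
    have "homotopic_paths C g h" using that by (simp add: path_class_def)
    then have "homotopic_paths S (p \<circ> g) (p \<circ> h)"
      by (rule homotopic_paths_continuous_image) (use p in auto)
    then show ?thesis using path_class_eq by blast
  qed
  then show ?thesis
    unfolding pi1_map_def using path_class_self[OF g] by blast
qed

lemma mem_cover_subgroup_iff:
  assumes p: "continuous_on C p" "p ` C \<subseteq> S"
  shows "A \<in> cover_subgroup C y p S \<longleftrightarrow> (\<exists>g. loop_at C y g \<and> A = path_class S (p \<circ> g))"
  unfolding cover_subgroup_def by (auto simp: image_iff pi1_map_class[OF p])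

text \<open>Pigeonhole: two different powers of \<open>x\<close> lie in the same coset, and their
  quotient is a power in \<open>N\<close>.\<close>

lemma (in group) power_in_finite_index_subgroup:
  assumes N: "subgroup N G" and fin: "finite (rcosets N)" and x: "x \<in> carrier G"
  obtains k :: nat where "k > 0" "x [^] k \<in> N"
proof -
  have "\<not> inj (\<lambda>k::nat. N #> x [^] k)"
  proof
    assume "inj (\<lambda>k::nat. N #> x [^] k)"
    moreover have "range (\<lambda>k::nat. N #> x [^] k) \<subseteq> rcosets N"
      using x subgroup.subset[OF N] by (auto intro: rcosetsI)
    ultimately show False
      using fin finite_subset finite_imageD infinite_UNIV_nat by blast
  qed
  then obtain i j :: nat where "i \<noteq> j" "N #> x [^] i = N #> x [^] j" by (auto simp: inj_on_def)
  then obtain i j :: nat where ij: "i < j" "N #> x [^] i = N #> x [^] j"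
    by (metis linorder_neqE_nat)
  have "x [^] j \<in> N #> x [^] i"
    unfolding ij(2) using N x by (intro rcos_self) auto
  then obtain h where h: "h \<in> N" "x [^] j = h \<otimes> x [^] i" by (auto simp: r_coset_def)
  have "x [^] j = x [^] (j - i) \<otimes> x [^] i" using x ij(1) by (simp add: nat_pow_mult)
  then have "h \<otimes> x [^] i = x [^] (j - i) \<otimes> x [^] i" using h(2) by simp
  then have "x [^] (j - i) = h"
    using x h(1) subgroup.subset[OF N] right_cancel[of "x [^] i" h "x [^] (j - i)"] by auto
  then show ?thesis using that[of "j - i"] ij(1) h(1) by simp
qed

lemma (in group) nat_pow_conj:
  assumes "x \<in> carrier G" "t \<in> carrier G"
  shows "(t \<otimes> x \<otimes> inv t) [^] (k::nat) = t \<otimes> x [^] k \<otimes> inv t"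
proof (induction k)
  case (Suc k)
  have "inv t \<otimes> (t \<otimes> w) = w" if "w \<in> carrier G" for w
    using that assms by (simp add: m_assoc[symmetric])
  then show ?case using Suc assms by (simp add: m_assoc)
qed (use assms in simp)

text \<open>The coset of a loop is determined by the endpoint of its lift at \<open>y\<close>: two
  lifts with the same endpoint differ by a loop in the cover. So there are at most as many cosets as
  points in the fibre.\<close>

lemma finite_rcosets_cover_subgroup:
  assumes cov: "covering_space C p S" and y: "y \<in> C" and fin: "finite {z\<in>C. p z = p y}"
    and N: "subgroup (cover_subgroup C y p S) (fundamental_group S (p y))"
  shows "finite (rcosets\<^bsub>fundamental_group S (p y)\<^esub> cover_subgroup C y p S)"
proof -
  let ?G = "fundamental_group S (p y)" and ?N = "cover_subgroup C y p S"
  have p: "continuous_on C p" "p ` C \<subseteq> S" using cov by (auto simp: covering_space_def)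
  interpret group ?G using y p by (intro group_fundamental_group) auto
  let ?P = "\<lambda>e l. path l \<and> path_image l \<subseteq> C \<and> pathstart l = y \<and> pathfinish l = e"
  \<comment> \<open>If no path from \<open>y\<close> reaches \<open>e\<close>, the choice is
    arbitrary; properties of \<open>L e\<close> are used only for endpoints of actual lifts.\<close>
  define L where "L e = (SOME l. ?P e l)" for e
  have "rcosets\<^bsub>?G\<^esub> ?N \<subseteq> (\<lambda>e. ?N #>\<^bsub>?G\<^esub> path_class S (p \<circ> L e)) ` {z\<in>C. p z = p y}"
  proof
    fix K assume "K \<in> rcosets\<^bsub>?G\<^esub> ?N"
    then obtain f where f: "loop_at S (p y) f" and K: "K = ?N #>\<^bsub>?G\<^esub> path_class S f"
      by (auto simp: RCOSETS_def)
    obtain l where l: "path l" "path_image l \<subseteq> C" "pathstart l = y" "\<And>t. t \<in> {0..1} \<Longrightarrow> p (l t) = f t"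
      using covering_space_path_lift[OF cov, of f y] f y by (auto simp: loop_at_def)
    define e where "e = pathfinish l"
    have e: "e \<in> C" "p e = p y"
      using l f by (auto simp: e_def loop_at_def pathfinish_def path_image_def)
    have "?P e (L e)" unfolding L_def by (rule someI[of "?P e" l]) (use l e_def in auto)
    then have L: "path (L e)" "path_image (L e) \<subseteq> C" "pathstart (L e) = y" "pathfinish (L e) = e" by auto
    have "homotopic_paths S f (p \<circ> l)"
      using f l(4) by (intro homotopic_paths_eq) (auto simp: loop_at_def)
    then have fl: "path_class S f = path_class S (p \<circ> l)" "loop_at S (p y) (p \<circ> l)"
      using path_class_eq loop_at_homotopic[OF f] by blast+
    have pL: "loop_at S (p y) (p \<circ> L e)"
      using L p e by (auto simp: loop_at_def path_image_compose pathstart_compose pathfinish_compose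
          intro!: path_continuous_image intro: continuous_on_subset)
    have "loop_at C y (l +++ reversepath (L e))"
      using l L by (auto simp: loop_at_def path_image_join e_def)
    then have "path_class S (p \<circ> (l +++ reversepath (L e))) \<in> ?N"
      using mem_cover_subgroup_iff[OF p] by blast
    moreover have "p \<circ> (l +++ reversepath (L e)) = (p \<circ> l) +++ reversepath (p \<circ> L e)"
      by (simp add: path_compose_join path_compose_reversepath)
    ultimately have *: "path_class S (p \<circ> l) \<otimes>\<^bsub>?G\<^esub> inv\<^bsub>?G\<^esub> path_class S (p \<circ> L e) \<in> ?N"
      using fl(2) pL by (simp add: inv_fundamental_group mult_fundamental_group loop_at_reversepath)
    have cl: "path_class S (p \<circ> l) \<in> carrier ?G" "path_class S (p \<circ> L e) \<in> carrier ?G"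
      using fl(2) pL by auto
    have "path_class S (p \<circ> l) = (path_class S (p \<circ> l) \<otimes>\<^bsub>?G\<^esub> inv\<^bsub>?G\<^esub> path_class S (p \<circ> L e))
        \<otimes>\<^bsub>?G\<^esub> path_class S (p \<circ> L e)"
      using cl by (simp only: m_assoc inv_closed l_inv r_one)
    then have "path_class S (p \<circ> l) \<in> ?N #>\<^bsub>?G\<^esub> path_class S (p \<circ> L e)"
      unfolding r_coset_def using * by blast
    then have "?N #>\<^bsub>?G\<^esub> path_class S (p \<circ> L e) = ?N #>\<^bsub>?G\<^esub> path_class S (p \<circ> l)"
      using cl(2) N by (rule repr_independence)
    then show "K \<in> (\<lambda>e. ?N #>\<^bsub>?G\<^esub> path_class S (p \<circ> L e)) ` {z\<in>C. p z = p y}"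
      using K fl(1) e by auto
  qed
  then show ?thesis using fin finite_surj by blast
qed

text \<open>Regularity of the cover: the n-th power of the conjugate is the conjugate of the n-th
  power, and the normal subgroup contains both or neither.\<close>

lemma simple_exponent_conjugate:
  assumes N: "cover_subgroup C y p S \<lhd> fundamental_group S (p y)"
    and \<gamma>: "\<gamma> \<in> carrier (fundamental_group S (p y))" and t: "t \<in> carrier (fundamental_group S (p y))"
  shows "simple_exponent C y p S
      (t \<otimes>\<^bsub>fundamental_group S (p y)\<^esub> \<gamma> \<otimes>\<^bsub>fundamental_group S (p y)\<^esub> inv\<^bsub>fundamental_group S (p y)\<^esub> t)
    = simple_exponent C y p S \<gamma>"
proof -
  let ?G = "fundamental_group S (p y)" and ?N = "cover_subgroup C y p S"
  interpret normal ?N ?G by fact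
  have "(t \<otimes>\<^bsub>?G\<^esub> \<gamma> \<otimes>\<^bsub>?G\<^esub> inv\<^bsub>?G\<^esub> t) [^]\<^bsub>?G\<^esub> n \<in> ?N \<longleftrightarrow> \<gamma> [^]\<^bsub>?G\<^esub> n \<in> ?N" for n :: nat
  proof -
    let ?u = "\<gamma> [^]\<^bsub>?G\<^esub> n"
    have u: "?u \<in> carrier ?G" using \<gamma> by (rule nat_pow_closed)
    have "inv\<^bsub>?G\<^esub> t \<otimes>\<^bsub>?G\<^esub> (t \<otimes>\<^bsub>?G\<^esub> ?u \<otimes>\<^bsub>?G\<^esub> inv\<^bsub>?G\<^esub> t) \<otimes>\<^bsub>?G\<^esub> t
        = (inv\<^bsub>?G\<^esub> t \<otimes>\<^bsub>?G\<^esub> t) \<otimes>\<^bsub>?G\<^esub> ?u \<otimes>\<^bsub>?G\<^esub> (inv\<^bsub>?G\<^esub> t \<otimes>\<^bsub>?G\<^esub> t)"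
      using t u by (simp only: m_assoc m_closed inv_closed)
    also have "\<dots> = ?u" using t u by (simp only: l_inv l_one r_one)
    finally show ?thesis
      using inv_op_closed1[OF t, of "t \<otimes>\<^bsub>?G\<^esub> ?u \<otimes>\<^bsub>?G\<^esub> inv\<^bsub>?G\<^esub> t"] inv_op_closed2[OF t, of ?u]
        nat_pow_conj[OF \<gamma> t, of n] by metis
  qed
  then show ?thesis by (simp add: simple_exponent_def)
qed

theorem proposition6p1:
  fixes S :: "'a::topological_space set" and S' :: "'b::topological_space set"
    and p :: "'b \<Rightarrow> 'a" and x0 :: 'a and y0 :: 'b
  assumes "orientable_surface S" and "compact S" and "connected S"
    and "finite_regular_cover S' y0 p S" and "p y0 = x0"
    and "rk_simple_homology S' y0 p S < rk_homology S'"
  shows "\<exists>d \<rho>. d \<ge> 1 \<and> \<rho> \<in> hom (fundamental_group S x0) (GL_int d) \<and>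
           infinite (\<rho> ` carrier (fundamental_group S x0)) \<and>
           (\<forall>\<gamma>. simple_element S x0 \<gamma> \<longrightarrow>
              (\<exists>k::nat. k > 0 \<and> \<rho> \<gamma> [^]\<^bsub>GL_int d\<^esub> k = \<one>\<^bsub>GL_int d\<^esub>)) \<and>
           virtually_abelian (GL_int d\<lparr>carrier := \<rho> ` carrier (fundamental_group S x0)\<rparr>)"
proof -
  let ?G = "fundamental_group S x0" and ?N = "cover_subgroup S' y0 p S"
  let ?H = "rat_homology 1 (top_of_set S')"
  have y0: "y0 \<in> S'" and S': "connected S'" and cov: "covering_space S' p S"
    and fibres: "\<forall>x\<in>S. finite {z\<in>S'. p z = x}" and N: "?N \<lhd> ?G"
    using assms(4,5) by (auto simp: finite_regular_cover_def)
  have p: "continuous_on S' p" "p ` S' \<subseteq> S" using cov by (auto simp: covering_space_def)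
  have x0: "x0 \<in> S" using p(2) y0 assms(5) by auto
  have surface: "surface S" using assms(1) by (simp add: orientable_surface_def)
  have compact: "compact S'" using cov assms(2) fibres by (rule compact_covering_space)
  have Hausdorff: "Hausdorff_space (top_of_set S')"
    by (rule Hausdorff_covering_space[OF cov conjunct1[OF surface[unfolded surface_def]]])
  have loc: "locally cell S'"
    using cov locally_cell_surface[OF surface] by (rule locally_cell_covering_space)
  have pc: "path_connected S'" using S' loc by (rule connected_locally_cell_imp_path_connected)
  have G: "group ?G" using x0 by (rule group_fundamental_group)
  interpret G: group ?G by fact
  have subN: "subgroup ?N ?G" using N by (rule normal_imp_subgroup)
  have finN: "finite (rcosets\<^bsub>?G\<^esub> ?N)"
    using finite_rcosets_cover_subgroup[OF cov y0] fibres x0 subN assms(5) by auto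
  \<comment> \<open>Cycles representing the generators of simple homology; the functional is to
    vanish on these chains themselves.\<close>
  define \<G> :: "'b rat_chain set" where "\<G> = {Poly_Mapping.single (path_simplex g) 1 | g \<gamma>.
      simple_element S x0 \<gamma> \<and> loop_at S' y0 g \<and> p \<circ> g \<in> \<gamma> [^]\<^bsub>?G\<^esub> simple_exponent S' y0 p S \<gamma>}"
  have "\<G> \<subseteq> rat_cycles 1 (top_of_set S')" using loop_rat_cycle by (auto simp: \<G>_def)
  moreover have "LinearCombinations.module.span class_ring ?H (rat_homology_class 1 (top_of_set S') ` \<G>)
      \<noteq> carrier ?H"
  proof
    assume eq: "LinearCombinations.module.span class_ring ?H (rat_homology_class 1 (top_of_set S') ` \<G>)
      = carrier ?H"
    have "rat_homology_class 1 (top_of_set S') ` \<G> = {loop_homology_class S' g | g \<gamma>.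
        simple_element S x0 \<gamma> \<and> loop_at S' y0 g \<and> p \<circ> g \<in> \<gamma> [^]\<^bsub>?G\<^esub> simple_exponent S' y0 p S \<gamma>}"
      unfolding \<G>_def loop_homology_class_def by blast
    then have "simple_homology S' y0 p S = carrier ?H"
      using eq by (simp add: simple_homology_def assms(5))
    \<comment> \<open>If the span were everything, both ranks would be the dimension of literally
      the same space, contradicting the strict inequality.\<close>
    then have "rk_simple_homology S' y0 p S = rk_homology S'"
      by (simp add: rk_simple_homology_def rk_homology_def)
    then show False using assms(6) by simp
  qed
  ultimately obtain \<psi> z where add: "\<And>c d. \<psi> (c + d) = \<psi> c + \<psi> d"
    and scale: "\<And>q c. \<psi> (rat_scale q c) = q * \<psi> c"
    and bd: "\<And>b. b \<in> rat_boundaries 1 (top_of_set S') \<Longrightarrow> \<psi> b = 0"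
    and simple: "\<And>c. c \<in> \<G> \<Longrightarrow> \<psi> c = 0"
    and z: "z \<in> rat_cycles 1 (top_of_set S')" "\<psi> z = (1 :: rat)"
    by (rule homology_functional) blast
  define F where "F g = \<psi> (Poly_Mapping.single (path_simplex g) 1)" for g
  interpret path_cocycle S' F
    unfolding F_def[abs_def] using add scale bd by (rule path_cocycle_functional)
  obtain m :: int where m: "m > 0"
    "\<And>g. path g \<Longrightarrow> path_image g \<subseteq> S' \<Longrightarrow> pathfinish g = pathstart g \<Longrightarrow> of_int m * F g \<in> \<int>"
    using bounded_denominators[OF compact Hausdorff loc] by blast
  \<comment> \<open>A functional vanishing on all loops at the base point would vanish on all
    cycles, but it is 1 at \<open>z\<close>.\<close>
  obtain a where a: "loop_at S' y0 a" "F a \<noteq> 0"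
    using functional_zero_on_cycles[OF add scale bd pc y0 _ z(1)] z(2) by (auto simp: F_def)
  \<comment> \<open>The floor only converts to the type \<open>int\<close>, because the scaled value
    on a loop is already integral. Any lift may be chosen: lifts with homotopic projections are
    homotopic. Outside \<open>?N\<close> the value is arbitrary.\<close>
  define \<phi> where "\<phi> A = \<lfloor>of_int m * F (SOME g. loop_at S' y0 g \<and> A = path_class S (p \<circ> g))\<rfloor>" for A
  have \<phi>: "of_int (\<phi> (path_class S (p \<circ> g))) = of_int m * F g" if g: "loop_at S' y0 g" for g
  proof -
    let ?h = "SOME h. loop_at S' y0 h \<and> path_class S (p \<circ> g) = path_class S (p \<circ> h)"
    have h: "loop_at S' y0 ?h \<and> path_class S (p \<circ> g) = path_class S (p \<circ> ?h)"
      by (rule someI[of _ g]) (use g in simp)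
    then have "loop_at S x0 (p \<circ> ?h)" using loop_at_image[OF p] assms(5) by blast
    then have "homotopic_paths S (p \<circ> g) (p \<circ> ?h)"
      using h path_class_eq_iff by (auto simp: loop_at_def)
    then have "homotopic_paths S' g ?h"
      using g h by (intro covering_space_homotopic_lifts[OF cov]) (auto simp: loop_at_def)
    then have "F g = F ?h" by (rule homotopic)
    moreover have "of_int m * F g \<in> \<int>" using g by (intro m(2)) (auto simp: loop_at_def)
    ultimately show ?thesis unfolding \<phi>_def by (metis floor_of_int Ints_cases)
  qed
  have inN: "A \<in> ?N \<longleftrightarrow> (\<exists>g. loop_at S' y0 g \<and> A = path_class S (p \<circ> g))" for A
    using p by (rule mem_cover_subgroup_iff)
  have \<phi>_hom: "\<phi> (A \<otimes>\<^bsub>?G\<^esub> B) = \<phi> A + \<phi> B" if AB: "A \<in> ?N" "B \<in> ?N" for A B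
  proof -
    obtain g h where gh: "loop_at S' y0 g" "A = path_class S (p \<circ> g)" "loop_at S' y0 h" "B = path_class S (p \<circ> h)"
      using AB inN by auto
    have "A \<otimes>\<^bsub>?G\<^esub> B = path_class S (p \<circ> (g +++ h))"
      using gh loop_at_image[OF p] assms(5) by (auto simp: mult_fundamental_group path_compose_join)
    moreover have "F (g +++ h) = F g + F h"
      using gh by (intro join) (auto simp: loop_at_def)
    ultimately have "rat_of_int (\<phi> (A \<otimes>\<^bsub>?G\<^esub> B)) = of_int (\<phi> A + \<phi> B)"
      using gh by (simp add: \<phi> loop_at_join algebra_simps)
    then show ?thesis by (simp only: of_int_eq_iff)
  qed
  have aN: "path_class S (p \<circ> a) \<in> ?N" using inN a(1) by blast
  have "rat_of_int (\<phi> (path_class S (p \<circ> a))) \<noteq> 0" using \<phi>[OF a(1)] a(2) m(1) by simp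
  then have "\<phi> (path_class S (p \<circ> a)) \<noteq> 0" by simp
  from integral_representation[OF G N finN \<phi>_hom aN this]
  obtain d \<rho> where d: "d \<ge> 1" and \<rho>: "\<rho> \<in> hom ?G (GL_int d)" and inf: "infinite (\<rho> ` carrier ?G)"
    and triv: "\<And>A. A \<in> ?N \<Longrightarrow> (\<And>t. t \<in> carrier ?G \<Longrightarrow> \<phi> (t \<otimes>\<^bsub>?G\<^esub> A \<otimes>\<^bsub>?G\<^esub> inv\<^bsub>?G\<^esub> t) = 0) \<Longrightarrow> \<rho> A = \<one>\<^bsub>GL_int d\<^esub>"
    and va: "virtually_abelian (GL_int d\<lparr>carrier := \<rho> ` carrier ?G\<rparr>)"
    by metis
  interpret \<rho>: group_hom ?G "GL_int d" \<rho>
    using G group_GL_int \<rho> by (simp add: group_hom_def group_hom_axioms_def)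
  \<comment> \<open>Any loop in the cover representing this power is one of the generators in \<G>,
    on which the functional vanishes.\<close>
  have vanish: "\<phi> (\<gamma> [^]\<^bsub>?G\<^esub> simple_exponent S' y0 p S \<gamma>) = 0"
    if \<gamma>: "simple_element S x0 \<gamma>" "\<gamma> [^]\<^bsub>?G\<^esub> simple_exponent S' y0 p S \<gamma> \<in> ?N" for \<gamma>
  proof -
    obtain g where g: "loop_at S' y0 g" "\<gamma> [^]\<^bsub>?G\<^esub> simple_exponent S' y0 p S \<gamma> = path_class S (p \<circ> g)"
      using \<gamma>(2) inN by auto
    have "p \<circ> g \<in> path_class S (p \<circ> g)"
      using loop_at_image[OF p g(1)] by (rule path_class_self)
    then have "Poly_Mapping.single (path_simplex g) 1 \<in> \<G>"
      using \<gamma>(1) g unfolding \<G>_def by auto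
    then have "F g = 0" unfolding F_def by (rule simple)
    then show ?thesis using \<phi>[OF g(1)] g(2) by simp
  qed
  have "\<exists>k::nat. k > 0 \<and> \<rho> \<gamma> [^]\<^bsub>GL_int d\<^esub> k = \<one>\<^bsub>GL_int d\<^esub>" if \<gamma>: "simple_element S x0 \<gamma>" for \<gamma>
  proof -
    have \<gamma>G: "\<gamma> \<in> carrier ?G" using \<gamma> unfolding simple_element_def by blast
    define k where "k = simple_exponent S' y0 p S \<gamma>"
    \<comment> \<open>Finite index ensures that the minimum defining the exponent is over a nonempty
      set.\<close>
    obtain j :: nat where "j > 0" "\<gamma> [^]\<^bsub>?G\<^esub> j \<in> ?N"
      using G.power_in_finite_index_subgroup[OF subN finN \<gamma>G] .
    then have "0 < j \<and> \<gamma> [^]\<^bsub>?G\<^esub> j \<in> ?N" ..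
    from LeastI[of "\<lambda>n. 0 < n \<and> \<gamma> [^]\<^bsub>?G\<^esub> n \<in> ?N", OF this]
    have k: "k > 0 \<and> \<gamma> [^]\<^bsub>?G\<^esub> k \<in> ?N"
      unfolding k_def simple_exponent_def assms(5) .
    have "\<rho> (\<gamma> [^]\<^bsub>?G\<^esub> k) = \<one>\<^bsub>GL_int d\<^esub>"
    proof (rule triv)
      show "\<gamma> [^]\<^bsub>?G\<^esub> k \<in> ?N" using k by blast
      fix t assume t: "t \<in> carrier ?G"
      \<comment> \<open>The conjugate is again simple and has the same exponent, so the conjugated
        power is the distinguished power of a simple element.\<close>
      let ?c = "t \<otimes>\<^bsub>?G\<^esub> \<gamma> \<otimes>\<^bsub>?G\<^esub> inv\<^bsub>?G\<^esub> t"
      have c: "simple_element S x0 ?c" using \<gamma> t by (rule simple_element_conjugate)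
      have exp: "simple_exponent S' y0 p S ?c = k"
        using simple_exponent_conjugate[of S' y0 p S \<gamma> t] N \<gamma>G t by (simp only: assms(5) k_def)
      have pow: "?c [^]\<^bsub>?G\<^esub> k = t \<otimes>\<^bsub>?G\<^esub> \<gamma> [^]\<^bsub>?G\<^esub> k \<otimes>\<^bsub>?G\<^esub> inv\<^bsub>?G\<^esub> t"
        using \<gamma>G t by (rule G.nat_pow_conj)
      have "?c [^]\<^bsub>?G\<^esub> k \<in> ?N"
        unfolding pow using k by (intro normal.inv_op_closed2[OF N t]) blast
      then show "\<phi> (t \<otimes>\<^bsub>?G\<^esub> \<gamma> [^]\<^bsub>?G\<^esub> k \<otimes>\<^bsub>?G\<^esub> inv\<^bsub>?G\<^esub> t) = 0"
        using vanish[OF c] by (simp only: exp pow)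
    qed
    then show ?thesis using k \<rho>.hom_nat_pow[OF \<gamma>G, of k] by (intro exI[of _ k]) simp
  qed
  then show ?thesis using d \<rho> inf va by blast
qed

end
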